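(* Let $d\ge1$ and let $h$ be a (real- or complex-valued) function on $\mathbb{R}$ such that $\int_{-\infty}^\infty(1+|\lambda|^d)|h(\lambda)|\,d\lambda<\infty$. For $0\le i\le d$ let $p_i$ be a monic polynomial of degree $i$, and let $p(c)=(p_0(c),p_1(c),\ldots,p_d(c))^\top$. Let $V=(v_{ij})_{1\le i,j\le d+1}$ with $$v_{ij}=\int_{-\infty<\lambda_1<\lambda_2<\infty}\det\begin{pmatrix} p_{i-1}(\lambda_1) & p_{j-1}(\lambda_1) \\ p_{i-1}(\lambda_2) & p_{j-1}(\lambda_2) \end{pmatrix}h(\lambda_1)h(\lambda_2)\,d\lambda_1\,d\lambda_2,$$ and $W=(w_1,\ldots,w_{d+1})^\top$ with $w_i=\int_{-\infty}^\infty p_{i-1}(\lambda)h(\lambda)\,d\lambda$. Then for all $c\in\mathbb{R}$ the integral $$\int_{-\infty<\lambda_1<\cdots<\lambda_d<\infty}\ \prod_{1\le i<j\le d}(\lambda_j-\lambda_i)\prod_{1\le i\le d}(\lambda_i-c)\prod_{i=1}^dh(\lambda_i)\prod_{i=1}^dd\lambda_i$$ equals $$\mathrm{pf}\begin{pmatrix} V & p(c) \\ -p(c)^\top & 0 \end{pmatrix}\quad\text{if } d \text{ is even},$$ and $$\mathrm{pf}\begin{pmatrix} V & W & p(c) \\ -W^\top & 0 & 1 \\ -p(c)^\top & -1 & 0 \end{pmatrix}-\mathrm{pf}(V)\quad\text{if } d \text{ is odd}.$$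
   Context: For a skew-symmetric $n\times n$ matrix $A=(a_{ij})$ with $n$ even, $\mathrm{pf}(A)=\sum_\pi\mathrm{sgn}(\pi)a_{\pi(1)\pi(2)}\cdots a_{\pi(n-1)\pi(n)}$, the sum being over permutations $\pi$ of $\{1,\dots,n\}$ with $\pi(2k-1)<\pi(2k)$ for all $k$ and $\pi(1)<\pi(3)<\cdots<\pi(n-1)$. Functions are Lebesgue measurable, as implied by the integrability hypothesis. *)

theory Defs
  imports "Jordan_Normal_Form.Determinant" "HOL-Analysis.Analysis"
begin

hide_type (open) Finite_Cartesian_Product.vec
hide_const (open) Determinants.det Finite_Cartesian_Product.vec Finite_Cartesian_Product.mat

text \<open>
  The Pfaffian of a skew-symmetric matrix of even size; outside this case the value carries no
  meaning. Matrix indices start at \<open>0\<close>, so the pairs \<open>(\<pi>(2k-1), \<pi>(2k))\<close> of the usual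
  one-based definition, \<open>k = 1, \<dots>, n/2\<close>, become \<open>(\<pi> (2*k), \<pi> (2*k+1))\<close> with \<open>k < n div 2\<close>.
\<close>

definition pfaffian_perms :: "nat \<Rightarrow> (nat \<Rightarrow> nat) set" where
  "pfaffian_perms n = {\<pi>. \<pi> permutes {0..<n} \<and>
     (\<forall>k < n div 2. \<pi> (2*k) < \<pi> (2*k+1)) \<and>
     (\<forall>k. k + 1 < n div 2 \<longrightarrow> \<pi> (2*k) < \<pi> (2*(k+1)))}"

definition pf :: "'a::comm_ring_1 mat \<Rightarrow> 'a" where
  "pf A = (\<Sum>\<pi>\<in>pfaffian_perms (dim_row A).
     of_int (sign \<pi>) * (\<Prod>k<dim_row A div 2. A $$ (\<pi> (2*k), \<pi> (2*k+1))))"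

text \<open>
  Lebesgue measure on \<open>\<real>\<^sup>d\<close> for varying \<open>d\<close>: points are functions on \<open>{1..d}\<close>, and
  Lebesgue measure is the completion of the product Borel measure.
\<close>

definition lebesgue_pow :: "nat \<Rightarrow> (nat \<Rightarrow> real) measure" where
  "lebesgue_pow d = completion (\<Pi>\<^sub>M i\<in>{1..d}. lborel)"

text \<open>
  The indices below run from \<open>0\<close> to \<open>d\<close>: entry \<open>(i, j)\<close> belongs to the polynomials
  \<open>p i\<close> and \<open>p j\<close>, of degrees \<open>i\<close> and \<open>j\<close>. The polynomials may have complex coefficients.
\<close>

definition pvec :: "nat \<Rightarrow> (nat \<Rightarrow> complex poly) \<Rightarrow> real \<Rightarrow> complex vec" where
  "pvec d p c = vec (d+1) (\<lambda>i. poly (p i) (of_real c))"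

definition Vmat :: "nat \<Rightarrow> (nat \<Rightarrow> complex poly) \<Rightarrow> (real \<Rightarrow> complex) \<Rightarrow> complex mat" where
  "Vmat d p h = mat (d+1) (d+1) (\<lambda>(i, j).
     LINT l:{l. fst l < snd l}|(lebesgue :: (real \<times> real) measure).
       det (mat_of_rows_list 2
         [[poly (p i) (of_real (fst l)), poly (p j) (of_real (fst l))],
          [poly (p i) (of_real (snd l)), poly (p j) (of_real (snd l))]])
       * h (fst l) * h (snd l))"

definition Wvec :: "nat \<Rightarrow> (nat \<Rightarrow> complex poly) \<Rightarrow> (real \<Rightarrow> complex) \<Rightarrow> complex vec" where
  "Wvec d p h = vec (d+1) (\<lambda>i. LINT l|lebesgue. poly (p i) (of_real l) * h l)"

definition skew_block_mat :: "'a::ring_1 mat \<Rightarrow> 'a mat \<Rightarrow> 'a mat \<Rightarrow> 'a mat" where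
  "skew_block_mat A B D = four_block_mat A B (- transpose_mat B) D"

end

theory Submission
  imports Defs
begin

text \<open>
  Put \<open>g\<^sub>i = p\<^sub>i h\<close>. Up to the sign \<open>(-1)^d\<close>, the integrand on the left is the Vandermonde product of the
  points \<open>\<lambda>\<^sub>1, \<dots>, \<lambda>\<^sub>d, c\<close> times the weights, that is, a determinant with rows \<open>(g\<^sub>j(\<lambda>\<^sub>k))\<^sub>j\<close> and
  \<open>(p\<^sub>j(c))\<^sub>j\<close> (\<open>det_monic_polys\<close>). Expanding it over permutations makes the left-hand side the sum of
  \<open>sgn \<sigma> J(\<sigma>) p\<^bsub>\<sigma>(d)\<^esub>(c)\<close>, where \<open>J(\<sigma>)\<close> is the integral of \<open>g\<^bsub>\<sigma>(0)\<^esub>(\<lambda>\<^sub>1) g\<^bsub>\<sigma>(1)\<^esub>(\<lambda>\<^sub>2) \<cdots>\<close> over the increasing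
  chamber \<open>\<lambda>\<^sub>1 < \<cdots> < \<lambda>\<^sub>d\<close> (\<open>integral_vandermonde_chamber\<close>). It remains to recognize this sum as a Pfaffian, which is
  de Bruijn's integration formula with a border.

  The entries of \<open>V\<close> are the integrals of \<open>g\<^sub>i(x) g\<^sub>j(y) sgn(y - x)\<close> over the plane. A product of such
  entries, with an entry of \<open>W\<close> if \<open>d\<close> is odd, is therefore an integral over all of \<open>\<real>\<close> to the power \<open>d\<close>.
  Cutting this space into the chambers on which the coordinates are ordered in a given way expresses the product by
  the numbers \<open>J\<close>, with products of signs as coefficients (\<open>integral_paired_integrand_chambers\<close>).
  After antisymmetrization in the indices all chambers contribute multiples of one and the same sum
  (\<open>signed_sum_integral_paired_integrand\<close>). The total multiplicity is the sum of
  \<open>sgn \<tau> \<Prod> sgn(\<tau>(2k+1) - \<tau>(2k))\<close> over all permutations \<open>\<tau>\<close>, which a sign-reversing involution shows to be the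
  order of the group \<open>H\<close> of permutations preserving the pairs \<open>{2k, 2k+1}\<close>
  (\<open>sum_signed_pair_prod_order_sign\<close>).

  The same group governs the Pfaffian: the permutations in its definition represent the cosets of \<open>H\<close>,
  and the summand is constant on cosets, so the order of \<open>H\<close> times the Pfaffian is the sum over the whole
  symmetric group (\<open>pfaffian_as_full_sum\<close>). Since \<open>H\<close> is transitive on positions, the index of the last column may be
  assumed to stand last, so that the border factors out (\<open>pf_bordered_even\<close>). For odd \<open>d\<close> the same is done
  with the last two columns: the terms in which their indices are paired carry the corner entry \<open>1\<close> and
  add up to the Pfaffian of \<open>V\<close>, which the statement subtracts; the others give the integral, and the
  sign \<open>(-1)^d = -1\<close> is that of the transposition which puts the two border indices into different pairs
  (\<open>pf_bordered_odd\<close>).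
\<close>

hide_const (open) Finite_Cartesian_Product.transpose

section \<open>Permutations that preserve the consecutive pairs\<close>

definition pair_prod :: "nat \<Rightarrow> (nat \<Rightarrow> nat \<Rightarrow> 'a::comm_ring_1) \<Rightarrow> (nat \<Rightarrow> nat) \<Rightarrow> 'a" where
  "pair_prod m a \<sigma> = (\<Prod>k<m. a (\<sigma> (2*k)) (\<sigma> (2*k+1)))"

definition signed_pair_prod :: "nat \<Rightarrow> (nat \<Rightarrow> nat \<Rightarrow> 'a::comm_ring_1) \<Rightarrow> (nat \<Rightarrow> nat) \<Rightarrow> 'a" where
  "signed_pair_prod m a \<sigma> = of_int (sign \<sigma>) * pair_prod m a \<sigma>"

text \<open>
  The kernel \<open>sgn (y - x)\<close>. On \<open>\<real>\<close> it turns the integrals over \<open>\<lambda>\<^sub>1 < \<lambda>\<^sub>2\<close> into integrals over the plane;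
  on \<open>\<nat>\<close> it records how a permutation orders the members of a pair.
\<close>

definition order_sign :: "'b::linorder \<Rightarrow> 'b \<Rightarrow> complex" where
  "order_sign x y = (if x < y then 1 else if y < x then - 1 else 0)"

text \<open>
  The prefix notation for inverses is taken by the inverse in an algebraic group.
\<close>

abbreviation inv_fun :: "('a \<Rightarrow> 'b) \<Rightarrow> 'b \<Rightarrow> 'a" where "inv_fun \<equiv> inv_into UNIV"

text \<open>
  The hyperoctahedral group, acting on positions. Giving it by generators makes invariance under it
  a matter of two transpositions; the intrinsic description by preserved pairs is recovered in
  \<open>paired_permutes_iff_pair_group\<close>.
\<close>

inductive_set pair_group :: "nat \<Rightarrow> (nat \<Rightarrow> nat) set" for m where
  id: "id \<in> pair_group m"
| flip: "\<tau> \<in> pair_group m \<Longrightarrow> k < m \<Longrightarrow> \<tau> \<circ> transpose (2*k) (2*k+1) \<in> pair_group m"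
| swap: "\<tau> \<in> pair_group m \<Longrightarrow> k < l \<Longrightarrow> l < m \<Longrightarrow>
    \<tau> \<circ> (transpose (2*k) (2*l) \<circ> transpose (2*k+1) (2*l+1)) \<in> pair_group m"

lemma flip_apply [simp]:
  "transpose (2*k) (Suc (2*k)) (2*i) = (if i = k then Suc (2*k) else 2*i)"
  "transpose (2*k) (Suc (2*k)) (Suc (2*i)) = (if i = k then 2*k else Suc (2*i))"
  by (auto simp: Transposition.transpose_def)

lemma swap_pairs_apply [simp]:
  "transpose (2*k) (2*l) (transpose (Suc (2*k)) (Suc (2*l)) (2*i)) = 2 * transpose k l i"
  "transpose (2*k) (2*l) (transpose (Suc (2*k)) (Suc (2*l)) (Suc (2*i))) = Suc (2 * transpose k l i)"
  by (auto simp: Transposition.transpose_def)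

lemma pair_group_permutes: "\<tau> \<in> pair_group m \<Longrightarrow> \<tau> permutes {..<2*m}"
proof (induction rule: pair_group.induct)
  case (flip \<tau> k)
  show ?case by (intro permutes_compose[OF _ flip(3)] permutes_swap_id) (use flip in auto)
next
  case (swap \<tau> k l)
  show ?case by (intro permutes_compose[OF _ swap(4)] permutes_compose[OF permutes_swap_id permutes_swap_id])
     (use swap in auto)
qed (simp only: permutes_id)

lemma finite_pair_group: "finite (pair_group m)"
  by (rule finite_subset[OF _ finite_permutations[of "{..<2*m}"]]) (auto dest: pair_group_permutes)

lemma pair_group_compose:
  "\<tau> \<in> pair_group m \<Longrightarrow> \<sigma> \<in> pair_group m \<Longrightarrow> \<sigma> \<circ> \<tau> \<in> pair_group m"
proof (induction rule: pair_group.induct)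
  case (flip \<tau> k) then show ?case using pair_group.flip[of "\<sigma> \<circ> \<tau>" m k] by (simp only: o_assoc)
next
  case (swap \<tau> k l) then show ?case using pair_group.swap[of "\<sigma> \<circ> \<tau>" m k l] by (simp only: o_assoc)
qed simp

lemma swap_pairs_involution:
  assumes "k < l"
  shows "(transpose (2*k) (2*l) \<circ> transpose (2*k+1) (2*l+1)) \<circ>
         (transpose (2*k) (2*l) \<circ> transpose (2*k+1) (2*l+1)) = (id :: nat \<Rightarrow> nat)"
proof
  fix x :: nat
  show "((transpose (2*k) (2*l) \<circ> transpose (2*k+1) (2*l+1)) \<circ>
         (transpose (2*k) (2*l) \<circ> transpose (2*k+1) (2*l+1))) x = id x"
    by (cases "even x") (auto elim!: evenE oddE)
qed

lemma pair_group_inv: "\<tau> \<in> pair_group m \<Longrightarrow> inv_fun \<tau> \<in> pair_group m"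
proof (induction rule: pair_group.induct)
  case (flip \<tau> k)
  let ?t = "transpose (2*k) (2*k+1)"
  have "inv_fun (\<tau> \<circ> ?t) = inv_fun ?t \<circ> inv_fun \<tau>"
    using permutes_bij[OF pair_group_permutes[OF flip(1)]] by (intro o_inv_distrib) auto
  moreover have "?t \<in> pair_group m" using pair_group.flip[OF pair_group.id flip(2)] by (simp only: id_comp)
  moreover have "inv_fun ?t = ?t" using inv_swap_id[of "2*k" "2*k+1"] by simp
  ultimately show ?case using pair_group_compose[OF flip(3)] by (simp only:)
next
  case (swap \<tau> k l)
  let ?t = "transpose (2*k) (2*l) \<circ> transpose (2*k+1) (2*l+1)"
  have t: "?t \<in> pair_group m" using pair_group.swap[OF pair_group.id swap(2,3)] by (simp only: id_comp)
  have "inv_fun (\<tau> \<circ> ?t) = inv_fun ?t \<circ> inv_fun \<tau>"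
    using permutes_bij[OF pair_group_permutes[OF swap(1)]] permutes_bij[OF pair_group_permutes[OF t]]
    by (intro o_inv_distrib)
  moreover have "inv_fun ?t = ?t" using swap_pairs_involution[OF swap(2)] by (intro inv_unique_comp)
  ultimately show ?case using pair_group_compose[OF swap(4) t] by (simp only:)
qed (simp only: inv_id pair_group.id)

text \<open>
  Flips move a position to the first place of its pair, and pair swaps connect the first places.
\<close>

lemma pair_group_transitive:
  assumes "a < 2*m" "b < 2*m"
  obtains \<eta> where "\<eta> \<in> pair_group m" "\<eta> b = a"
proof -
  have to_even: "\<exists>\<eta>\<in>pair_group m. \<eta> x = 2 * (x div 2)" if "x < 2*m" for x
  proof (cases "even x")
    case True
    then have "id x = 2 * (x div 2)" by simp
    then show ?thesis using pair_group.id by blast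
  next
    case False
    then obtain e where e: "x = 2*e + 1" by (rule oddE)
    let ?t = "transpose (2*e) (2*e+1)"
    have "?t x = 2*e" unfolding e by (rule transpose_apply_second)
    moreover have "?t \<in> pair_group m"
      using pair_group.flip[OF pair_group.id, of e m] that e by (simp only: id_comp)
    moreover have "2 * (x div 2) = 2*e" using e by simp
    ultimately show ?thesis by metis
  qed
  have swap: "\<exists>\<eta>\<in>pair_group m. \<eta> (2*k) = 2*l" if "k < l" "l < m" for k l
  proof -
    let ?t = "transpose (2*k) (2*l) \<circ> transpose (2*k+1) (2*l+1)"
    have "?t (2*k) = 2*l" by simp
    moreover have "?t \<in> pair_group m"
      using pair_group.swap[OF pair_group.id that] by (simp only: id_comp)
    ultimately show ?thesis by blast
  qed
  have swap': "\<exists>\<eta>\<in>pair_group m. \<eta> (2*k) = 2*l" if "k < m" "l < m" for k l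
  proof -
    consider "k < l" | "k = l" | "l < k" by linarith
    then show ?thesis
    proof cases
      case 1 then show ?thesis using swap[OF 1 that(2)] by simp
    next
      case 2
      then have "id (2*k) = 2*l" by simp
      then show ?thesis using pair_group.id by blast
    next
      case 3
      obtain \<eta> where \<eta>: "\<eta> \<in> pair_group m" "\<eta> (2*l) = 2*k" using swap[OF 3 \<open>k < m\<close>] by blast
      have "inv_fun \<eta> (2*k) = 2*l"
        using permutes_inverses(2)[OF pair_group_permutes[OF \<eta>(1)], of "2*l"] unfolding \<eta>(2) .
      then show ?thesis using pair_group_inv[OF \<eta>(1)] by blast
    qed
  qed
  have half: "a div 2 < m" "b div 2 < m" using assms by linarith+
  obtain \<alpha> where \<alpha>: "\<alpha> \<in> pair_group m" "\<alpha> a = 2 * (a div 2)" using to_even[OF assms(1)] by blast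
  obtain \<beta> where \<beta>: "\<beta> \<in> pair_group m" "\<beta> b = 2 * (b div 2)" using to_even[OF assms(2)] by blast
  obtain \<gamma> where \<gamma>: "\<gamma> \<in> pair_group m" "\<gamma> (2 * (b div 2)) = 2 * (a div 2)"
    using swap'[OF half(2,1)] by blast
  have \<alpha>_inv: "inv_fun \<alpha> (2 * (a div 2)) = a"
    using permutes_inverses(2)[OF pair_group_permutes[OF \<alpha>(1)], of a] unfolding \<alpha>(2) .
  have "inv_fun \<alpha> \<circ> (\<gamma> \<circ> \<beta>) \<in> pair_group m"
    by (rule pair_group_compose[OF pair_group_compose[OF \<beta>(1) \<gamma>(1)] pair_group_inv[OF \<alpha>(1)]])
  moreover have "(inv_fun \<alpha> \<circ> (\<gamma> \<circ> \<beta>)) b = a" by (simp only: o_apply \<beta>(2) \<gamma>(2) \<alpha>_inv)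
  ultimately show thesis by (rule that)
qed

definition skew_on :: "nat \<Rightarrow> (nat \<Rightarrow> nat \<Rightarrow> 'a::comm_ring_1) \<Rightarrow> bool" where
  "skew_on n a \<longleftrightarrow> (\<forall>i<n. \<forall>j<n. a j i = - a i j)"

text \<open>
  A flip changes the sign of the permutation and, by skew symmetry, of one factor; a pair swap is an
  even permutation and only reorders the factors.
\<close>

lemma signed_pair_prod_invariant:
  assumes "\<tau> \<in> pair_group m" "\<sigma> permutes {..<n}" "2*m \<le> n" "skew_on n a"
  shows "signed_pair_prod m a (\<sigma> \<circ> \<tau>) = signed_pair_prod m a \<sigma>"
  using assms(1)
proof (induction rule: pair_group.induct)
  case (flip \<tau> k)
  let ?t = "transpose (2*k) (2*k+1)" and ?s = "\<sigma> \<circ> \<tau>"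
  have perm: "?s permutes {..<n}"
    using assms(2,3) permutes_subset[OF pair_group_permutes[OF flip(1)], of "{..<n}"]
    by (auto intro: permutes_compose)
  have fac: "(\<Prod>i<m. F i) = F k * (\<Prod>i\<in>{..<m}-{k}. F i)" for F :: "nat \<Rightarrow> 'a"
    using flip(2) by (subst prod.remove[of _ k]) auto
  have rest: "(\<Prod>i\<in>{..<m}-{k}. a ((?s \<circ> ?t) (2*i)) ((?s \<circ> ?t) (2*i+1))) =
      (\<Prod>i\<in>{..<m}-{k}. a (?s (2*i)) (?s (2*i+1)))"
    by (rule prod.cong) auto
  have "?s (2*k) < n" "?s (2*k+1) < n"
    using permutes_in_image[OF perm, of "2*k"] permutes_in_image[OF perm, of "2*k+1"] flip(2) assms(3) by auto
  then have "a (?s (2*k+1)) (?s (2*k)) = - a (?s (2*k)) (?s (2*k+1))"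
    using assms(4) unfolding skew_on_def by blast
  then have prod: "pair_prod m a (?s \<circ> ?t) = - pair_prod m a ?s"
    unfolding pair_prod_def fac rest by simp
  have "sign (?s \<circ> ?t) = - sign ?s"
    using perm permutation_permutes by (subst sign_compose) (auto simp: sign_swap_id intro: permutation_swap_id)
  then have "signed_pair_prod m a (?s \<circ> ?t) = signed_pair_prod m a ?s"
    unfolding signed_pair_prod_def prod by simp
  then show ?case using flip(3) by (simp only: o_assoc)
next
  case (swap \<tau> k l)
  let ?t = "transpose (2*k) (2*l) \<circ> transpose (2*k+1) (2*l+1)" and ?s = "\<sigma> \<circ> \<tau>"
  have perm: "?s permutes {..<n}"
    using assms(2,3) permutes_subset[OF pair_group_permutes[OF swap(1)], of "{..<n}"]
    by (auto intro: permutes_compose)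
  have t: "?t (2*i) = 2 * transpose k l i" "?t (2*i+1) = 2 * transpose k l i + 1" for i
    by simp_all
  have "pair_prod m a (?s \<circ> ?t) = (\<Prod>i<m. a (?s (2 * transpose k l i)) (?s (2 * transpose k l i + 1)))"
    unfolding pair_prod_def using t by simp
  also have "\<dots> = pair_prod m a ?s"
    unfolding pair_prod_def
    using prod.reindex_bij_betw[OF permutes_imp_bij[of "transpose k l" "{..<m}"],
        of "\<lambda>i. a (?s (2*i)) (?s (2*i+1))"] swap(2,3)
    by (simp add: permutes_swap_id)
  finally have prod: "pair_prod m a (?s \<circ> ?t) = pair_prod m a ?s" .
  have "sign ?t = 1" using swap(2) by (subst sign_compose) (auto simp: sign_swap_id intro: permutation_swap_id)
  then have "sign (?s \<circ> ?t) = sign ?s"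
    using perm permutation_permutes by (subst sign_compose) (auto intro: permutation_compose permutation_swap_id)
  then have "signed_pair_prod m a (?s \<circ> ?t) = signed_pair_prod m a ?s"
    unfolding signed_pair_prod_def prod by simp
  then show ?case using swap(4) by (simp only: o_assoc)
qed simp

section \<open>The Pfaffian as a sum over the whole symmetric group\<close>

text \<open>
  Permutations that map pairs onto pairs, without reference to generators.
\<close>

definition paired :: "nat \<Rightarrow> (nat \<Rightarrow> nat) \<Rightarrow> bool" where
  "paired m \<tau> \<longleftrightarrow> (\<forall>k<m. \<exists>j<m. \<tau> ` {2*k, 2*k+1} = {2*j, 2*j+1})"

lemma paired_compose: "paired m \<sigma> \<Longrightarrow> paired m \<tau> \<Longrightarrow> paired m (\<sigma> \<circ> \<tau>)"
  unfolding paired_def image_comp[symmetric] by metis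

lemma pair_group_paired: "\<tau> \<in> pair_group m \<Longrightarrow> paired m \<tau>"
proof (induction rule: pair_group.induct)
  case id show ?case by (auto simp: paired_def)
next
  case (flip \<tau> k)
  have "transpose (2*k) (2*k+1) ` {2*i, 2*i+1} = {2*i, 2*i+1}" for i
    by auto
  then show ?case by (intro paired_compose[OF flip(3)]) (auto simp: paired_def)
next
  case (swap \<tau> k l)
  have "transpose (2*k) (2*l) (transpose (2*k+1) (2*l+1) (2*i)) = 2 * transpose k l i"
    "transpose (2*k) (2*l) (transpose (2*k+1) (2*l+1) (2*i+1)) = 2 * transpose k l i + 1" for i
    by simp_all
  moreover have "transpose k l i < m" if "i < m" for i
    using swap(2,3) that by (auto simp: Transposition.transpose_def)
  ultimately show ?case
    by (intro paired_compose[OF swap(4)]) (force simp: paired_def image_comp[symmetric])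
qed

text \<open>
  An increasing map of an initial segment of \<open>\<nat>\<close> into itself leaves no room to move.
\<close>

lemma strict_mono_below_self:
  fixes \<rho> :: "nat \<Rightarrow> nat"
  assumes "\<And>k l. k < l \<Longrightarrow> l < m \<Longrightarrow> \<rho> k < \<rho> l" "\<And>k. k < m \<Longrightarrow> \<rho> k < m" "k < m"
  shows "\<rho> k = k"
  using assms
proof (induction m arbitrary: k)
  case (Suc m)
  have below: "\<rho> k < m" if "k < m" for k
  proof -
    have "\<rho> k < \<rho> m" "\<rho> m < Suc m" using Suc.prems(1)[of k m] Suc.prems(2)[of m] that by simp_all
    then show ?thesis by linarith
  qed
  have IH: "\<rho> k = k" if "k < m" for k
    by (rule Suc.IH[OF _ below that]) (rule Suc.prems(1), assumption, erule less_SucI)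
  have "\<rho> m = m"
  proof (cases m)
    case (Suc m')
    then have "\<rho> m' = m'" "\<rho> m' < \<rho> m" "\<rho> m < Suc m"
      using IH[of m'] Suc.prems(1)[of m' m] Suc.prems(2)[of m] by simp_all
    then show ?thesis using Suc by linarith
  next
    case 0
    then show ?thesis using Suc.prems(2)[of m] by simp
  qed
  then show ?case using IH[of k] Suc.prems(3) by (cases "k = m") simp_all
qed simp

lemma pfaffian_perms_even_mono:
  assumes "\<pi> \<in> pfaffian_perms (2*m)" "k < l" "l < m"
  shows "\<pi> (2*k) < \<pi> (2*l)"
  using assms(2,3)
proof (induction l)
  case (Suc l)
  have "\<pi> (2*l) < \<pi> (2*(l+1))" using assms(1) Suc.prems by (auto simp: pfaffian_perms_def)
  then show ?case using Suc by (cases "k = l") auto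
qed simp

text \<open>
  A coset of the pair group contains at most one Pfaffian permutation: preserving pairs, \<open>\<tau>\<close> cannot
  exchange the members of a pair because both permutations list the smaller one first, and it
  cannot permute the pairs because both list them by increasing first member.
\<close>

lemma pfaffian_perms_paired_unique:
  assumes \<pi>: "\<pi> \<in> pfaffian_perms (2*m)" and \<tau>: "paired m \<tau>" "\<tau> permutes {..<2*m}"
    and \<pi>\<tau>: "\<pi> \<circ> \<tau> \<in> pfaffian_perms (2*m)"
  shows "\<tau> = id"
proof -
  have ex: "\<exists>j<m. \<tau> (2*k) = 2*j \<and> \<tau> (2*k+1) = 2*j+1" if "k < m" for k
  proof -
    obtain j where "j < m" and im: "\<tau> ` {2*k, 2*k+1} = {2*j, 2*j+1}"
      using \<tau>(1) \<open>k < m\<close> unfolding paired_def by blast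
    from im have "\<tau> (2*k) = 2*j \<and> \<tau> (2*k+1) = 2*j+1 \<or> \<tau> (2*k) = 2*j+1 \<and> \<tau> (2*k+1) = 2*j"
      by (simp only: image_insert image_empty doubleton_eq_iff)
    moreover have "\<pi> (\<tau> (2*k)) < \<pi> (\<tau> (2*k+1))" "\<pi> (2*j) < \<pi> (2*j+1)"
      using \<pi> \<pi>\<tau> that \<open>j < m\<close> unfolding pfaffian_perms_def by auto
    ultimately show ?thesis using \<open>j < m\<close> by (metis less_asym)
  qed
  then have "\<forall>k. \<exists>j. k < m \<longrightarrow> j < m \<and> \<tau> (2*k) = 2*j \<and> \<tau> (2*k+1) = 2*j+1" by blast
  from choice[OF this] obtain \<rho>
    where \<rho>: "\<And>k. k < m \<Longrightarrow> \<rho> k < m \<and> \<tau> (2*k) = 2 * \<rho> k \<and> \<tau> (2*k+1) = 2 * \<rho> k + 1" by blast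
  have "\<rho> k < \<rho> l" if "k < l" "l < m" for k l
  proof (rule ccontr)
    assume "\<not> \<rho> k < \<rho> l"
    then have "\<pi> (2 * \<rho> l) \<le> \<pi> (2 * \<rho> k)"
      using pfaffian_perms_even_mono[OF \<pi>, of "\<rho> l" "\<rho> k"] \<rho>[of k] that by (cases "\<rho> k = \<rho> l") auto
    moreover have "\<pi> (2 * \<rho> k) < \<pi> (2 * \<rho> l)"
      using pfaffian_perms_even_mono[OF \<pi>\<tau> that] \<rho>[of k] \<rho>[of l] that by simp
    ultimately show False by simp
  qed
  then have "\<rho> k = k" if "k < m" for k
    using \<rho> that by (intro strict_mono_below_self[of m \<rho> k]) simp_all
  then have fixed: "\<tau> (2*k) = 2*k" "\<tau> (2*k+1) = 2*k+1" if "k < m" for k using \<rho>[OF that] that by simp_all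
  show ?thesis
  proof
    fix x
    show "\<tau> x = id x"
    proof (cases "x < 2*m")
      case True
      then have "x div 2 < m" by linarith
      from fixed[OF this] show ?thesis by (cases "even x") (auto elim!: evenE oddE)
    next
      case False
      then show ?thesis using permutes_not_in[OF \<tau>(2)] by simp
    qed
  qed
qed

text \<open>
  A coset of the pair group contains at least one Pfaffian permutation: minimizing a cost over the
  coset sorts both the pairs and their members.
\<close>

lemma ex_pair_group_pfaffian_perm:
  assumes "\<sigma> permutes {..<2*m}"
  shows "\<exists>\<tau>\<in>pair_group m. \<sigma> \<circ> \<tau> \<in> pfaffian_perms (2*m)"
proof -
  \<comment> \<open>The weights \<open>m - k\<close> are positive, so a smaller first member lowers the cost, and decreasing,
    so listing the pairs by increasing first member does.\<close>
  define cost where "cost \<tau> = (\<Sum>k<m. (m - k) * \<sigma> (\<tau> (2*k)))" for \<tau>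
  obtain \<tau> where \<tau>: "\<tau> \<in> pair_group m" and min: "\<And>\<tau>'. \<tau>' \<in> pair_group m \<Longrightarrow> cost \<tau> \<le> cost \<tau>'"
    using ex_has_least_nat[of "\<lambda>\<tau>. \<tau> \<in> pair_group m" id cost] pair_group.id by blast
  have perm: "\<sigma> \<circ> \<tau> permutes {..<2*m}" using permutes_compose[OF pair_group_permutes[OF \<tau>] assms] .
  then have inj: "inj (\<sigma> \<circ> \<tau>)" using permutes_inj by blast
  have pair: "\<sigma> (\<tau> (2*k)) < \<sigma> (\<tau> (2*k+1))" if "k < m" for k
  proof (rule ccontr)
    assume "\<not> ?thesis"
    moreover have "\<sigma> (\<tau> (2*k)) \<noteq> \<sigma> (\<tau> (2*k+1))" using injD[OF inj, of "2*k" "2*k+1"] by auto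
    ultimately have less: "\<sigma> (\<tau> (2*k+1)) < \<sigma> (\<tau> (2*k))" by simp
    let ?t = "transpose (2*k) (2*k+1)"
    have "cost (\<tau> \<circ> ?t) < cost \<tau>"
      unfolding cost_def
    proof (rule sum_strict_mono_ex1)
      show "\<forall>i\<in>{..<m}. (m - i) * \<sigma> ((\<tau> \<circ> ?t) (2*i)) \<le> (m - i) * \<sigma> (\<tau> (2*i))"
        using less by auto
      show "\<exists>i\<in>{..<m}. (m - i) * \<sigma> ((\<tau> \<circ> ?t) (2*i)) < (m - i) * \<sigma> (\<tau> (2*i))"
        using less that by (intro bexI[of _ k]) auto
    qed simp
    then show False using min[OF pair_group.flip[OF \<tau> that]] by linarith
  qed
  have firsts: "\<sigma> (\<tau> (2*k)) < \<sigma> (\<tau> (2*(k+1)))" if "k + 1 < m" for k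
  proof (rule ccontr)
    assume "\<not> ?thesis"
    moreover have "\<sigma> (\<tau> (2*k)) \<noteq> \<sigma> (\<tau> (2*(k+1)))" using injD[OF inj, of "2*k" "2*(k+1)"] by auto
    ultimately have less: "\<sigma> (\<tau> (2*(k+1))) < \<sigma> (\<tau> (2*k))" by simp
    let ?t = "transpose (2*k) (2*(k+1)) \<circ> transpose (2*k+1) (2*(k+1)+1)"
    have t: "?t (2*i) = 2 * transpose k (k+1) i" for i
      using swap_pairs_apply(1)[of k "k+1" i] by simp
    have split: "(\<Sum>i<m. F i) = F k + (F (k+1) + (\<Sum>i\<in>{..<m}-{k}-{k+1}. F i))" for F :: "nat \<Rightarrow> nat"
    proof -
      have "(\<Sum>i<m. F i) = F k + (\<Sum>i\<in>{..<m}-{k}. F i)" using that by (intro sum.remove) simp_all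
      also have "(\<Sum>i\<in>{..<m}-{k}. F i) = F (k+1) + (\<Sum>i\<in>{..<m}-{k}-{k+1}. F i)"
        using that by (intro sum.remove) simp_all
      finally show ?thesis .
    qed
    have rest: "(\<Sum>i\<in>{..<m}-{k}-{k+1}. (m - i) * \<sigma> ((\<tau> \<circ> ?t) (2*i))) =
        (\<Sum>i\<in>{..<m}-{k}-{k+1}. (m - i) * \<sigma> (\<tau> (2*i)))"
    proof (rule sum.cong[OF refl])
      fix i assume "i \<in> {..<m}-{k}-{k+1}"
      then have "transpose k (k+1) i = i" by (intro transpose_apply_other) simp_all
      then have "(\<tau> \<circ> ?t) (2*i) = \<tau> (2*i)" using t[of i] by (simp only: o_apply)
      then show "(m - i) * \<sigma> ((\<tau> \<circ> ?t) (2*i)) = (m - i) * \<sigma> (\<tau> (2*i))" by (simp only:)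
    qed
    have moved: "(\<tau> \<circ> ?t) (2*k) = \<tau> (2*(k+1))" "(\<tau> \<circ> ?t) (2*(k+1)) = \<tau> (2*k)"
      using t[of k] t[of "k+1"] by (simp_all only: o_apply transpose_apply_first transpose_apply_second)
    define r where "r = m - (k+1)"
    have r: "m - k = Suc r" "m - (k+1) = r" using \<open>k + 1 < m\<close> unfolding r_def by linarith+
    have "cost (\<tau> \<circ> ?t) < cost \<tau>"
      unfolding cost_def split rest moved r mult_Suc using less by linarith
    then show False using min[OF pair_group.swap[OF \<tau>, of k "k+1"]] that by linarith
  qed
  have "\<sigma> \<circ> \<tau> \<in> pfaffian_perms (2*m)"
    using perm pair firsts by (simp add: pfaffian_perms_def lessThan_atLeast0)
  then show ?thesis using \<tau> by blast
qed

lemma pfaffian_perms_permutes: "\<pi> \<in> pfaffian_perms n \<Longrightarrow> \<pi> permutes {..<n}"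
  by (simp add: pfaffian_perms_def lessThan_atLeast0)

lemma paired_permutes_in_pair_group:
  assumes "paired m \<tau>" "\<tau> permutes {..<2*m}"
  shows "\<tau> \<in> pair_group m"
proof -
  obtain \<eta> where \<eta>: "\<eta> \<in> pair_group m" "\<tau> \<circ> \<eta> \<in> pfaffian_perms (2*m)"
    using ex_pair_group_pfaffian_perm[OF assms(2)] by blast
  have "\<tau> \<circ> \<eta> = id"
    using \<eta> pfaffian_perms_permutes[OF \<eta>(2)] paired_compose[OF assms(1) pair_group_paired[OF \<eta>(1)]]
    by (intro pfaffian_perms_paired_unique[of id m]) (auto simp: pfaffian_perms_def permutes_id)
  then have "\<tau> = inv_fun \<eta>"
    using permutes_bij[OF pair_group_permutes[OF \<eta>(1)]] by (metis bij_is_surj comp_id comp_assoc id_comp surj_iff)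
  then show ?thesis using pair_group_inv \<eta> by simp
qed

text \<open>
  The Pfaffian permutations represent the cosets of the pair group.
\<close>

lemma bij_betw_pfaffian_perms_pair_group:
  "bij_betw (\<lambda>(\<pi>, \<tau>). \<pi> \<circ> \<tau>) (pfaffian_perms (2*m) \<times> pair_group m) {\<sigma>. \<sigma> permutes {..<2*m}}"
  unfolding bij_betw_def
proof
  show "inj_on (\<lambda>(\<pi>, \<tau>). \<pi> \<circ> \<tau>) (pfaffian_perms (2*m) \<times> pair_group m)"
  proof (rule inj_onI, clarify)
    fix \<pi> \<tau> \<pi>' \<tau>'
    assume \<pi>: "\<pi> \<in> pfaffian_perms (2*m)" "\<pi>' \<in> pfaffian_perms (2*m)"
      and \<tau>: "\<tau> \<in> pair_group m" "\<tau>' \<in> pair_group m" and eq: "\<pi> \<circ> \<tau> = \<pi>' \<circ> \<tau>'"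
    have inv: "\<tau>' \<circ> inv_fun \<tau>' = id" "inv_fun \<tau>' \<circ> \<tau>' = id"
      using permutes_inv_o[OF pair_group_permutes[OF \<tau>(2)]] by auto
    have in_grp: "\<tau> \<circ> inv_fun \<tau>' \<in> pair_group m" using \<tau> by (simp add: pair_group_compose pair_group_inv)
    have "\<pi> \<circ> (\<tau> \<circ> inv_fun \<tau>') = \<pi>'" using eq inv by (metis comp_assoc comp_id)
    then have "\<tau> \<circ> inv_fun \<tau>' = id"
      using \<pi> in_grp by (intro pfaffian_perms_paired_unique[OF \<pi>(1)] pair_group_paired pair_group_permutes) auto
    then have "\<tau> = \<tau>'" using inv by (metis comp_assoc comp_id id_comp)
    moreover have "\<pi> = \<pi>'" using eq inv \<open>\<tau> = \<tau>'\<close> by (metis comp_assoc comp_id)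
    ultimately show "\<pi> = \<pi>' \<and> \<tau> = \<tau>'" by simp
  qed
  show "(\<lambda>(\<pi>, \<tau>). \<pi> \<circ> \<tau>) ` (pfaffian_perms (2*m) \<times> pair_group m) = {\<sigma>. \<sigma> permutes {..<2*m}}"
  proof safe
    fix \<pi> \<tau> assume "\<pi> \<in> pfaffian_perms (2*m)" "\<tau> \<in> pair_group m"
    then show "\<pi> \<circ> \<tau> permutes {..<2*m}"
      by (intro permutes_compose pair_group_permutes pfaffian_perms_permutes)
  next
    fix \<sigma> :: "nat \<Rightarrow> nat" assume \<sigma>: "\<sigma> permutes {..<2*m}"
    obtain \<tau> where \<tau>: "\<tau> \<in> pair_group m" "\<sigma> \<circ> \<tau> \<in> pfaffian_perms (2*m)"
      using ex_pair_group_pfaffian_perm[OF \<sigma>] by blast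
    have "\<sigma> = (\<sigma> \<circ> \<tau>) \<circ> inv_fun \<tau>"
      using permutes_inv_o(1)[OF pair_group_permutes[OF \<tau>(1)]] by (simp add: comp_assoc)
    then show "\<sigma> \<in> (\<lambda>(\<pi>, \<tau>). \<pi> \<circ> \<tau>) ` (pfaffian_perms (2*m) \<times> pair_group m)"
      using \<tau> pair_group_inv by (intro image_eqI[of _ _ "(\<sigma> \<circ> \<tau>, inv_fun \<tau>)"]) auto
  qed
qed

text \<open>
  The summand is constant on the cosets of the pair group, and the Pfaffian takes one term from each.
  The full sum is easier to handle, since it can be reindexed by any permutation.
\<close>

theorem pfaffian_as_full_sum:
  fixes A :: "'a::comm_ring_1 mat"
  assumes "dim_row A = 2*m" "skew_on (2*m) (\<lambda>i j. A $$ (i, j))"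
  shows "(\<Sum>\<sigma> | \<sigma> permutes {..<2*m}. signed_pair_prod m (\<lambda>i j. A $$ (i, j)) \<sigma>) =
    of_nat (card (pair_group m)) * pf A"
proof -
  let ?f = "signed_pair_prod m (\<lambda>i j. A $$ (i, j))"
  have "(\<Sum>\<sigma> | \<sigma> permutes {..<2*m}. ?f \<sigma>) = (\<Sum>(\<pi>, \<tau>)\<in>pfaffian_perms (2*m) \<times> pair_group m. ?f (\<pi> \<circ> \<tau>))"
    by (subst sum.reindex_bij_betw[OF bij_betw_pfaffian_perms_pair_group, symmetric])
       (simp add: case_prod_unfold)
  also have "\<dots> = (\<Sum>(\<pi>, \<tau>)\<in>pfaffian_perms (2*m) \<times> pair_group m. ?f \<pi>)"
    by (intro sum.cong) (auto intro!: signed_pair_prod_invariant[of _ m _ "2*m"] assms(2) pfaffian_perms_permutes)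
  also have "\<dots> = of_nat (card (pair_group m)) * (\<Sum>\<pi>\<in>pfaffian_perms (2*m). ?f \<pi>)"
    by (simp add: sum.cartesian_product[symmetric] sum_distrib_left)
  also have "(\<Sum>\<pi>\<in>pfaffian_perms (2*m). ?f \<pi>) = pf A"
    using assms(1) by (simp add: pf_def signed_pair_prod_def pair_prod_def)
  finally show ?thesis .
qed

section \<open>The signed count of pairs in order\<close>

lemma order_sign_swap_adjacent:
  assumes "a \<noteq> b" "{a, b} \<noteq> {2*q, 2*q+1 :: nat}"
  shows "order_sign (transpose (2*q) (2*q+1) a) (transpose (2*q) (2*q+1) b) = order_sign a b"
proof -
  have "transpose (2*q) (2*q+1) a < transpose (2*q) (2*q+1) b \<longleftrightarrow> a < b"
    using assms unfolding Transposition.transpose_def by (auto split: if_splits)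
  moreover have "transpose (2*q) (2*q+1) b < transpose (2*q) (2*q+1) a \<longleftrightarrow> b < a"
    using assms unfolding Transposition.transpose_def by (auto split: if_splits)
  ultimately show ?thesis unfolding order_sign_def by (simp only:)
qed

text \<open>
  Exchanging two neighbouring values \<open>2q, 2q+1\<close> changes no comparison except the one between them, so
  if they do not form a pair only the sign of the permutation changes.
\<close>

lemma signed_pair_prod_order_sign_antisym:
  assumes \<tau>: "\<tau> permutes {..<n}" "n div 2 = m" and q: "q < m"
    and un: "\<forall>j<m. \<tau> ` {2*j, 2*j+1} \<noteq> {2*q, 2*q+1}"
  shows "signed_pair_prod m order_sign (transpose (2*q) (2*q+1) \<circ> \<tau>) = - signed_pair_prod m order_sign \<tau>"
proof -
  let ?t = "transpose (2*q) (2*q+1)"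
  have "pair_prod m order_sign (?t \<circ> \<tau>) = pair_prod m order_sign \<tau>"
    unfolding pair_prod_def
  proof (rule prod.cong[OF refl])
    fix j assume "j \<in> {..<m}"
    then have "\<tau> ` {2*j, 2*j+1} \<noteq> {2*q, 2*q+1}" using un by simp
    moreover have "\<tau> (2*j) \<noteq> \<tau> (2*j+1)" using injD[OF permutes_inj[OF \<tau>(1)], of "2*j" "2*j+1"] by auto
    ultimately show "order_sign ((?t \<circ> \<tau>) (2*j)) ((?t \<circ> \<tau>) (2*j+1)) = order_sign (\<tau> (2*j)) (\<tau> (2*j+1))"
      using order_sign_swap_adjacent[of "\<tau> (2*j)" "\<tau> (2*j+1)" q] by (simp only: o_apply image_insert image_empty) simp
  qed
  moreover have "sign (?t \<circ> \<tau>) = - sign \<tau>"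
  proof -
    have "permutation \<tau>" using \<tau>(1) permutation_permutes by (metis finite_lessThan)
    then have "sign (?t \<circ> \<tau>) = sign ?t * sign \<tau>" by (intro sign_compose permutation_swap_id)
    also have "sign ?t = - 1" by (simp add: sign_swap_id)
    finally show ?thesis by (simp only: mult_minus1)
  qed
  ultimately show ?thesis unfolding signed_pair_prod_def by simp
qed

lemma covers_iff_paired_inverse:
  assumes "\<tau> permutes {..<n}"
  shows "(\<forall>q<m. \<exists>j<m. \<tau> ` {2*j, 2*j+1} = {2*q, 2*q+1}) \<longleftrightarrow> paired m (inv_fun \<tau>)"
proof -
  have bij: "bij \<tau>" using assms permutes_bij by blast
  have "\<tau> ` A = B \<longleftrightarrow> inv_fun \<tau> ` B = A" for A B
  proof
    assume "\<tau> ` A = B"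
    then show "inv_fun \<tau> ` B = A" using image_inv_f_f[OF bij_is_inj[OF bij]] by metis
  next
    assume "inv_fun \<tau> ` B = A"
    then show "\<tau> ` A = B" using image_f_inv_f[OF bij_is_surj[OF bij]] by metis
  qed
  then show ?thesis unfolding paired_def by (simp only:)
qed

text \<open>
  For an odd number of positions this separates the last one, which belongs to no pair, from the others.
\<close>

lemma paired_image:
  assumes "paired m \<tau>" "inj \<tau>"
  shows "\<tau> ` {..<2*m} = {..<2*m}"
proof (rule endo_inj_surj)
  show "\<tau> ` {..<2*m} \<subseteq> {..<2*m}"
  proof
    fix y assume "y \<in> \<tau> ` {..<2*m}"
    then obtain x where x: "x < 2*m" "y = \<tau> x" by blast
    then have "x div 2 < m" by linarith
    then obtain j where j: "j < m" "\<tau> ` {2*(x div 2), 2*(x div 2)+1} = {2*j, 2*j+1}"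
      using assms(1) unfolding paired_def by blast
    have "x \<in> {2*(x div 2), 2*(x div 2)+1}" by (cases "even x") (auto elim!: evenE oddE)
    then have "y \<in> {2*j, 2*j+1}" using j(2) x(2) by (metis imageI)
    then show "y \<in> {..<2*m}" using j(1) by auto
  qed
  show "inj_on \<tau> {..<2*m}" using assms(2) by (rule inj_on_subset) simp
qed simp

lemma paired_permutes_iff_pair_group:
  assumes "n div 2 = m"
  shows "\<tau> permutes {..<n} \<and> paired m \<tau> \<longleftrightarrow> \<tau> \<in> pair_group m"
proof
  have le: "2*m \<le> n" "n \<le> 2*m+1" using assms by linarith+
  assume \<tau>: "\<tau> permutes {..<n} \<and> paired m \<tau>"
  then have im: "\<tau> ` {..<2*m} = {..<2*m}" using paired_image permutes_inj by blast
  have bij: "bij \<tau>" using \<tau> permutes_bij by blast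
  have "\<tau> x = x" if "x \<notin> {..<2*m}" for x
  proof (cases "x < n")
    case True
    then have x: "x = 2*m" "n = 2*m+1" using that le by auto
    have "\<tau> x < n" using permutes_in_image[of \<tau> "{..<n}" x] \<tau> True by simp
    moreover have "\<tau> x \<notin> {..<2*m}"
    proof
      assume "\<tau> x \<in> {..<2*m}"
      then have "\<tau> x \<in> \<tau> ` {..<2*m}" by (simp only: im)
      then show False using that inj_image_mem_iff[OF bij_is_inj[OF bij]] by blast
    qed
    ultimately show ?thesis using x by simp
  next
    case False
    then show ?thesis using permutes_not_in[of \<tau> "{..<n}" x] \<tau> by simp
  qed
  then have "\<tau> permutes {..<2*m}"
    using im inj_on_subset[OF bij_is_inj[OF bij] subset_UNIV] by (intro bij_imp_permutes) (simp_all add: bij_betw_def)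
  then show "\<tau> \<in> pair_group m" using paired_permutes_in_pair_group \<tau> by blast
next
  assume "\<tau> \<in> pair_group m"
  then show "\<tau> permutes {..<n} \<and> paired m \<tau>"
    using pair_group_paired permutes_subset[OF pair_group_permutes, of \<tau> m "{..<n}"] assms by auto
qed

text \<open>
  The terms cancel in couples unless the values \<open>2q, 2q+1\<close> form a pair for every \<open>q\<close>; imposing this for
  \<open>q = 0, 1, \<dots>\<close> in turn leaves exactly the pair group, on which the summand is \<open>1\<close>. This is the constant
  by which the ordered chambers contribute to a Pfaffian of double integrals.
\<close>

theorem sum_signed_pair_prod_order_sign:
  assumes "n div 2 = m"
  shows "(\<Sum>\<tau> | \<tau> permutes {..<n}. signed_pair_prod m order_sign \<tau>) = of_nat (card (pair_group m))"
proof -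
  let ?f = "signed_pair_prod m (order_sign :: nat \<Rightarrow> nat \<Rightarrow> complex)"
  define covers where "covers q \<tau> \<longleftrightarrow> (\<exists>j<m. \<tau> ` {2*j, 2*j+1} = {2*q, 2*q+1})" for q and \<tau> :: "nat \<Rightarrow> nat"
  define C where "C q = {\<tau>. \<tau> permutes {..<n} \<and> (\<forall>q'<q. covers q' \<tau>)}" for q
  have fin: "finite (C q)" for q
    unfolding C_def by (rule finite_subset[OF _ finite_permutations[of "{..<n}"]]) auto
  have reduce: "sum ?f {\<tau>. \<tau> permutes {..<n}} = sum ?f (C q)" if "q \<le> m" for q
    using that
  proof (induction q)
    case 0 show ?case unfolding C_def by simp
  next
    case (Suc q)
    let ?t = "transpose (2*q) (2*q+1)"
    \<comment> \<open>Exchanging the values \<open>2q, 2q+1\<close> maps every set of the form \<open>{2q', 2q'+1}\<close> to itself, so the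
      conditions imposed before survive, and so does the failure of the new one.\<close>
    let ?U = "C q - C (Suc q)"
    have tt: "?t \<circ> (?t \<circ> \<tau>) = \<tau>" for \<tau> :: "nat \<Rightarrow> nat"
      by (simp only: o_assoc transpose_comp_involutory id_comp)
    have pair: "?t ` {2*q', 2*q'+1} = {2*q', 2*q'+1}" for q' by auto
    have covers_t: "covers q' (?t \<circ> \<tau>)" if "covers q' \<tau>" for q' \<tau>
      using that unfolding covers_def image_comp[symmetric] by (metis pair)
    have covers_iff: "covers q' (?t \<circ> \<tau>) \<longleftrightarrow> covers q' \<tau>" for q' \<tau>
      using covers_t[of q' \<tau>] covers_t[of q' "?t \<circ> \<tau>"] unfolding tt by blast
    have t: "?t permutes {..<n}" using Suc.prems assms by (intro permutes_swap_id) auto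
    have C_t: "?t \<circ> \<tau> \<in> C q'" if "\<tau> \<in> C q'" for q' \<tau>
      using that covers_iff t unfolding C_def by (auto intro: permutes_compose simp del: One_nat_def)
    have U_t: "?t \<circ> \<tau> \<in> ?U" if "\<tau> \<in> ?U" for \<tau>
      using C_t[of \<tau> q] C_t[of "?t \<circ> \<tau>" "Suc q"] that unfolding tt by blast
    have "sum ?f ?U = sum (\<lambda>\<tau>. - ?f \<tau>) ?U"
    proof (rule sum.reindex_bij_witness[of _ "\<lambda>\<tau>. ?t \<circ> \<tau>" "\<lambda>\<tau>. ?t \<circ> \<tau>"])
      fix \<tau> assume \<tau>: "\<tau> \<in> ?U"
      then have "\<tau> permutes {..<n}" "\<forall>j<m. \<tau> ` {2*j, 2*j+1} \<noteq> {2*q, 2*q+1}"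
        unfolding C_def covers_def by (auto simp: less_Suc_eq simp del: One_nat_def)
      then show "- ?f (?t \<circ> \<tau>) = ?f \<tau>"
        using signed_pair_prod_order_sign_antisym[of \<tau> n m q] assms Suc.prems by simp
    qed (use tt U_t in blast)+
    then have "sum ?f ?U = 0" by (simp add: sum_negf)
    moreover have "C (Suc q) \<subseteq> C q" unfolding C_def by auto
    ultimately have "sum ?f (C q) = sum ?f (C (Suc q))"
      using sum.subset_diff[OF _ fin[of q], of "C (Suc q)" ?f] by simp
    then show ?case using Suc by simp
  qed
  \<comment> \<open>The values of each pair are consecutive if and only if the inverse permutation preserves the pairs.\<close>
  have C_m: "C m = pair_group m"
  proof
    show "C m \<subseteq> pair_group m"
    proof
      fix \<tau> assume "\<tau> \<in> C m"
      then have \<tau>: "\<tau> permutes {..<n}" "\<forall>q<m. covers q \<tau>" unfolding C_def by auto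
      have "paired m (inv_fun \<tau>)"
        using covers_iff_paired_inverse[OF \<tau>(1), of m] \<tau>(2) unfolding covers_def by (simp only:)
      then have "inv_fun \<tau> \<in> pair_group m"
        using paired_permutes_iff_pair_group[OF assms, of "inv_fun \<tau>"] permutes_inv[OF \<tau>(1)] by blast
      then show "\<tau> \<in> pair_group m"
        using pair_group_inv[of "inv_fun \<tau>" m] inv_inv_eq[OF permutes_bij[OF \<tau>(1)]] by (simp only:)
    qed
    show "pair_group m \<subseteq> C m"
    proof
      fix \<tau> assume \<tau>: "\<tau> \<in> pair_group m"
      then have p: "\<tau> permutes {..<n}" "inv_fun \<tau> \<in> pair_group m"
        using paired_permutes_iff_pair_group[OF assms, of \<tau>] pair_group_inv by blast+
      then show "\<tau> \<in> C m"
        using covers_iff_paired_inverse[OF p(1), of m] pair_group_paired[OF p(2)]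
        unfolding C_def covers_def by (simp only: mem_Collect_eq simp_thms)
    qed
  qed
  have "?f \<tau> = 1" if "\<tau> \<in> pair_group m" for \<tau>
  proof -
    have "?f (id \<circ> \<tau>) = ?f id"
    proof (rule signed_pair_prod_invariant[OF that])
      show "skew_on (2*m) (order_sign :: nat \<Rightarrow> nat \<Rightarrow> complex)"
        unfolding skew_on_def order_sign_def by auto
    qed (simp_all only: permutes_id order_refl)
    also have "?f id = 1" unfolding signed_pair_prod_def pair_prod_def order_sign_def by simp
    finally show ?thesis by (simp only: id_comp)
  qed
  then have "sum ?f (C m) = of_nat (card (pair_group m))" unfolding C_m by simp
  then show ?thesis using reduce[of m] by simp
qed

section \<open>Moving the last indices of a Pfaffian to the last positions\<close>

lemma skew_on_mono: "skew_on n w \<Longrightarrow> k \<le> n \<Longrightarrow> skew_on k w"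
  unfolding skew_on_def by (meson less_le_trans)

lemma permutes_Suc_fixing_last:
  "{\<sigma>. \<sigma> permutes {..<Suc n} \<and> \<sigma> n = n} = {\<sigma>. \<sigma> permutes {..<n}}"
proof safe
  fix \<sigma> :: "nat \<Rightarrow> nat" assume "\<sigma> permutes {..<Suc n}" "\<sigma> n = n"
  moreover from this have "\<forall>x\<in>{..<Suc n} - {..<n}. \<sigma> x = x" by (simp add: less_Suc_eq)
  ultimately show "\<sigma> permutes {..<n}" by (metis permutes_superset)
next
  fix \<sigma> :: "nat \<Rightarrow> nat" assume \<sigma>: "\<sigma> permutes {..<n}"
  show "\<sigma> permutes {..<Suc n}" by (rule permutes_subset[OF \<sigma>]) simp
  show "\<sigma> n = n" by (rule permutes_not_in[OF \<sigma>]) simp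
qed

lemma sum_permutes_split_position:
  fixes f :: "(nat \<Rightarrow> nat) \<Rightarrow> 'a::comm_monoid_add"
  assumes "v < n"
  shows "(\<Sum>\<sigma> | \<sigma> permutes {..<n}. f \<sigma>) = (\<Sum>b<n. \<Sum>\<sigma> | \<sigma> permutes {..<n} \<and> \<sigma> b = v. f \<sigma>)"
proof -
  have pos: "inv_fun \<sigma> v \<in> {..<n}" if "\<sigma> permutes {..<n}" for \<sigma>
    using permutes_in_image[OF permutes_inv[OF that], of v] assms by simp
  have "(\<Sum>\<sigma> | \<sigma> permutes {..<n}. f \<sigma>) =
      (\<Sum>b<n. sum f {\<sigma> \<in> {\<sigma>. \<sigma> permutes {..<n}}. inv_fun \<sigma> v = b})"
  proof (rule sum.group[symmetric])
    show "(\<lambda>\<sigma>. inv_fun \<sigma> v) ` {\<sigma>. \<sigma> permutes {..<n}} \<subseteq> {..<n}" using pos by blast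
  qed (simp_all add: finite_permutations)
  also have "\<dots> = (\<Sum>b<n. \<Sum>\<sigma> | \<sigma> permutes {..<n} \<and> \<sigma> b = v. f \<sigma>)"
  proof (rule sum.cong[OF refl], rule sum.cong[OF _ refl])
    show "{\<sigma> \<in> {\<sigma>. \<sigma> permutes {..<n}}. inv_fun \<sigma> v = b} = {\<sigma>. \<sigma> permutes {..<n} \<and> \<sigma> b = v}" for b
      using permutes_inv_eq[of _ "{..<n}" v b] by blast
  qed
  finally show ?thesis .
qed

lemma sum_permutes_move_position:
  fixes f :: "(nat \<Rightarrow> nat) \<Rightarrow> 'a::comm_monoid_add"
  assumes "\<eta> permutes (S :: nat set)" "\<eta> b = a" "\<And>\<sigma>. \<sigma> permutes S \<Longrightarrow> f (\<sigma> \<circ> \<eta>) = f \<sigma>"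
  shows "(\<Sum>\<sigma> | \<sigma> permutes S \<and> \<sigma> a = v. f \<sigma>) = (\<Sum>\<sigma> | \<sigma> permutes S \<and> \<sigma> b = v. f \<sigma>)"
proof (rule sum.reindex_bij_witness[of _ "\<lambda>\<sigma>. \<sigma> \<circ> inv_fun \<eta>" "\<lambda>\<sigma>. \<sigma> \<circ> \<eta>"])
  note inv = permutes_inv_o[OF assms(1)]
  fix \<sigma> :: "nat \<Rightarrow> nat"
  show "\<sigma> \<circ> \<eta> \<circ> inv_fun \<eta> = \<sigma>" "\<sigma> \<circ> inv_fun \<eta> \<circ> \<eta> = \<sigma>"
    by (simp_all only: o_assoc[symmetric] inv comp_id)
  show "\<sigma> \<circ> \<eta> \<in> {\<sigma>. \<sigma> permutes S \<and> \<sigma> b = v}" if "\<sigma> \<in> {\<sigma>. \<sigma> permutes S \<and> \<sigma> a = v}"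
    using that permutes_compose[OF assms(1), of \<sigma>] by (simp only: mem_Collect_eq o_apply assms(2))
  have "inv_fun \<eta> a = b" using permutes_inv_eq[OF assms(1), of a b] assms(2) by blast
  show "\<sigma> \<circ> inv_fun \<eta> \<in> {\<sigma>. \<sigma> permutes S \<and> \<sigma> a = v}" if "\<sigma> \<in> {\<sigma>. \<sigma> permutes S \<and> \<sigma> b = v}"
    using that permutes_compose[OF permutes_inv[OF assms(1)], of \<sigma>]
    by (simp only: mem_Collect_eq o_apply \<open>inv_fun \<eta> a = b\<close>)
  show "f (\<sigma> \<circ> \<eta>) = f \<sigma>" if "\<sigma> \<in> {\<sigma>. \<sigma> permutes S \<and> \<sigma> a = v}"
    using that assms(3)[of \<sigma>] by (simp only: mem_Collect_eq)
qed

lemma sum_signed_pair_prod_position: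
  assumes "a < 2*m" "b < 2*m" "2*m \<le> n" "skew_on n w"
  shows "(\<Sum>\<sigma> | \<sigma> permutes {..<n} \<and> \<sigma> a = v. signed_pair_prod m w \<sigma>) =
         (\<Sum>\<sigma> | \<sigma> permutes {..<n} \<and> \<sigma> b = v. signed_pair_prod m w \<sigma>)"
proof -
  obtain \<eta> where \<eta>: "\<eta> \<in> pair_group m" "\<eta> b = a" using pair_group_transitive[OF assms(1,2)] .
  show ?thesis
  proof (rule sum_permutes_move_position[of \<eta>])
    show "\<eta> permutes {..<n}"
      using permutes_subset[OF pair_group_permutes[OF \<eta>(1)], of "{..<n}"] assms(3) by simp
    show "signed_pair_prod m w (\<sigma> \<circ> \<eta>) = signed_pair_prod m w \<sigma>" if "\<sigma> permutes {..<n}" for \<sigma>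
      using signed_pair_prod_invariant[OF \<eta>(1) that assms(3,4)] by (simp only:)
  qed (fact \<eta>(2))
qed

text \<open>
  By transitivity of the pair group every position of the last index contributes the same amount, so
  this index may be put last. The factor that contains it then involves only the last column.
\<close>

lemma sum_signed_pair_prod_fix_last:
  assumes "skew_on (2*m+2) w"
  shows "(\<Sum>\<sigma> | \<sigma> permutes {..<2*m+2}. signed_pair_prod (m+1) w \<sigma>) =
    of_nat (2*m+2) * (\<Sum>\<sigma> | \<sigma> permutes {..<2*m+1}. signed_pair_prod m w \<sigma> * w (\<sigma> (2*m)) (2*m+1))"
proof -
  let ?n = "2*m+2" and ?f = "signed_pair_prod (m+1) w"
  have "sum ?f {\<sigma>. \<sigma> permutes {..<?n}} = (\<Sum>b<?n. \<Sum>\<sigma> | \<sigma> permutes {..<?n} \<and> \<sigma> b = 2*m+1. ?f \<sigma>)"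
    by (rule sum_permutes_split_position) simp
  also have "\<dots> = (\<Sum>b<?n. \<Sum>\<sigma> | \<sigma> permutes {..<?n} \<and> \<sigma> (2*m+1) = 2*m+1. ?f \<sigma>)"
    by (rule sum.cong[OF refl], rule sum_signed_pair_prod_position) (use assms in simp_all)
  also have "\<dots> = of_nat ?n * (\<Sum>\<sigma> | \<sigma> permutes {..<?n} \<and> \<sigma> (2*m+1) = 2*m+1. ?f \<sigma>)"
    by (simp only: sum_constant card_lessThan)
  also have "{\<sigma>. \<sigma> permutes {..<?n} \<and> \<sigma> (2*m+1) = 2*m+1} = {\<sigma>. \<sigma> permutes {..<2*m+1}}"
    using permutes_Suc_fixing_last[of "2*m+1"] by simp
  also have "(\<Sum>\<sigma> | \<sigma> permutes {..<2*m+1}. ?f \<sigma>) =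
      (\<Sum>\<sigma> | \<sigma> permutes {..<2*m+1}. signed_pair_prod m w \<sigma> * w (\<sigma> (2*m)) (2*m+1))"
  proof (rule sum.cong[OF refl], clarify)
    fix \<sigma> :: "nat \<Rightarrow> nat" assume \<sigma>: "\<sigma> permutes {..<2*m+1}"
    then have "\<sigma> (2*m+1) = 2*m+1" by (rule permutes_not_in) simp
    then show "?f \<sigma> = signed_pair_prod m w \<sigma> * w (\<sigma> (2*m)) (2*m+1)"
      unfolding signed_pair_prod_def pair_prod_def by (simp add: mult.assoc)
  qed
  finally show ?thesis .
qed

text \<open>
  Apply the preceding lemma to the signs of order, for which both sums are known. All comparisons
  with the last index are \<open>1\<close>, so the border disappears.
\<close>

lemma card_pair_group_Suc: "card (pair_group (m+1)) = (2*m+2) * card (pair_group m)"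
proof -
  let ?s = "order_sign :: nat \<Rightarrow> nat \<Rightarrow> complex"
  have "of_nat (card (pair_group (m+1))) = (\<Sum>\<tau> | \<tau> permutes {..<2*m+2}. signed_pair_prod (m+1) ?s \<tau>)"
    by (rule sum_signed_pair_prod_order_sign[symmetric]) simp
  also have "\<dots> = of_nat (2*m+2) *
      (\<Sum>\<tau> | \<tau> permutes {..<2*m+1}. signed_pair_prod m ?s \<tau> * ?s (\<tau> (2*m)) (2*m+1))"
    by (rule sum_signed_pair_prod_fix_last) (auto simp: skew_on_def order_sign_def)
  also have "(\<Sum>\<tau> | \<tau> permutes {..<2*m+1}. signed_pair_prod m ?s \<tau> * ?s (\<tau> (2*m)) (2*m+1)) =
      (\<Sum>\<tau> | \<tau> permutes {..<2*m+1}. signed_pair_prod m ?s \<tau>)"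
  proof (rule sum.cong[OF refl], clarify)
    fix \<tau> :: "nat \<Rightarrow> nat" assume "\<tau> permutes {..<2*m+1}"
    then have "\<tau> (2*m) < 2*m+1" using permutes_in_image[of \<tau> "{..<2*m+1}" "2*m"] by simp
    then have "?s (\<tau> (2*m)) (2*m+1) = 1" by (simp add: order_sign_def)
    then show "signed_pair_prod m ?s \<tau> * ?s (\<tau> (2*m)) (2*m+1) = signed_pair_prod m ?s \<tau>" by (simp only: mult_1_right)
  qed
  also have "\<dots> = of_nat (card (pair_group m))" by (rule sum_signed_pair_prod_order_sign) simp
  finally have "(of_nat (card (pair_group (m+1))) :: complex) = of_nat ((2*m+2) * card (pair_group m))"
    by (simp only: of_nat_mult)
  then show ?thesis by (simp only: of_nat_eq_iff)
qed

text \<open>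
  After the last index, the one before it is moved as well. Either it is the partner of the last
  index, which gives the first term, or it can be moved to position \<open>2m+1\<close>, that is, to the last place
  of the last complete pair; exchanging it with the partner of the last index costs a sign.
\<close>

lemma sum_signed_pair_prod_fix_last_two:
  assumes "skew_on (2*m+4) w"
  shows "(\<Sum>\<sigma> | \<sigma> permutes {..<2*m+4}. signed_pair_prod (m+2) w \<sigma>) =
    of_nat (2*m+4) * ((\<Sum>\<sigma> | \<sigma> permutes {..<2*m+2}. signed_pair_prod (m+1) w \<sigma>) * w (2*m+2) (2*m+3)
      - of_nat (2*m+2) * (\<Sum>\<sigma> | \<sigma> permutes {..<2*m+2}.
          signed_pair_prod m w \<sigma> * w (\<sigma> (2*m)) (2*m+2) * w (\<sigma> (2*m+1)) (2*m+3)))"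
proof -
  let ?n = "2*m+3" and ?g = "\<lambda>\<sigma>. signed_pair_prod (m+1) w \<sigma> * w (\<sigma> (2*m+2)) (2*m+3)"
  let ?at = "\<lambda>b. {\<sigma>. \<sigma> permutes {..<?n} \<and> \<sigma> b = 2*m+2}"
  let ?r = "transpose (2*m+1) (2*m+2)"
  have skew: "skew_on ?n w" using skew_on_mono[OF assms, of ?n] by simp
  have move: "sum ?g (?at b) = sum ?g (?at (2*m+1))" if "b < 2*m+2" for b
  proof -
    obtain \<eta> where \<eta>: "\<eta> \<in> pair_group (m+1)" "\<eta> (2*m+1) = b"
      by (rule pair_group_transitive[of b "m+1" "2*m+1"]) (use \<open>b < 2*m+2\<close> in simp_all)
    show ?thesis
    proof (rule sum_permutes_move_position[of \<eta>])
      show "\<eta> permutes {..<?n}"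
        using permutes_subset[OF pair_group_permutes[OF \<eta>(1)], of "{..<?n}"] by simp
      have "\<eta> (2*m+2) = 2*m+2" using permutes_not_in[OF pair_group_permutes[OF \<eta>(1)]] by simp
      moreover have "signed_pair_prod (m+1) w (\<sigma> \<circ> \<eta>) = signed_pair_prod (m+1) w \<sigma>" if "\<sigma> permutes {..<?n}" for \<sigma>
        by (rule signed_pair_prod_invariant[OF \<eta>(1) that _ skew]) simp
      ultimately show "?g (\<sigma> \<circ> \<eta>) = ?g \<sigma>" if "\<sigma> permutes {..<?n}" for \<sigma>
        using that by (simp only: o_apply)
    qed (fact \<eta>(2))
  qed
  have last: "sum ?g (?at (2*m+2)) =
      (\<Sum>\<sigma> | \<sigma> permutes {..<2*m+2}. signed_pair_prod (m+1) w \<sigma>) * w (2*m+2) (2*m+3)"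
  proof -
    have "?at (2*m+2) = {\<sigma>. \<sigma> permutes {..<2*m+2}}"
      using permutes_Suc_fixing_last[of "2*m+2"] by (simp add: numeral_3_eq_3)
    then have "sum ?g (?at (2*m+2)) =
        (\<Sum>\<sigma> | \<sigma> permutes {..<2*m+2}. signed_pair_prod (m+1) w \<sigma> * w (2*m+2) (2*m+3))"
    proof (rule sum.cong)
      fix \<sigma> :: "nat \<Rightarrow> nat" assume "\<sigma> \<in> {\<sigma>. \<sigma> permutes {..<2*m+2}}"
      then have "\<sigma> (2*m+2) = 2*m+2" using permutes_not_in[of \<sigma> "{..<2*m+2}" "2*m+2"] by simp
      then show "?g \<sigma> = signed_pair_prod (m+1) w \<sigma> * w (2*m+2) (2*m+3)" by (simp only:)
    qed
    then show ?thesis by (simp only: sum_distrib_right)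
  qed
  have inner: "sum ?g (?at (2*m+1)) = - (\<Sum>\<sigma> | \<sigma> permutes {..<2*m+2}.
      signed_pair_prod m w \<sigma> * w (\<sigma> (2*m)) (2*m+2) * w (\<sigma> (2*m+1)) (2*m+3))" (is "_ = - ?R")
  proof -
    have rr: "?r \<circ> ?r = id" by (rule transpose_comp_involutory)
    have r: "?r permutes {..<?n}" by (intro permutes_swap_id) auto
    have "sum ?g (?at (2*m+1)) = (\<Sum>\<sigma> | \<sigma> permutes {..<?n} \<and> \<sigma> (2*m+2) = 2*m+2. ?g (\<sigma> \<circ> ?r))"
    proof (rule sum.reindex_bij_witness[of _ "\<lambda>\<sigma>. \<sigma> \<circ> ?r" "\<lambda>\<sigma>. \<sigma> \<circ> ?r"])
      fix \<sigma> :: "nat \<Rightarrow> nat"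
      show "\<sigma> \<circ> ?r \<circ> ?r = \<sigma>" by (simp only: o_assoc[symmetric] rr comp_id)
      then show "?g (\<sigma> \<circ> ?r \<circ> ?r) = ?g \<sigma>" by (simp only:)
      show "\<sigma> \<circ> ?r \<circ> ?r = \<sigma>" by (simp only: o_assoc[symmetric] rr comp_id)
      show "\<sigma> \<circ> ?r \<in> {\<sigma>. \<sigma> permutes {..<?n} \<and> \<sigma> (2*m+2) = 2*m+2}" if "\<sigma> \<in> ?at (2*m+1)"
        using that permutes_compose[OF r, of \<sigma>]
        by (simp only: mem_Collect_eq o_apply transpose_apply_first transpose_apply_second)
      show "\<sigma> \<circ> ?r \<in> ?at (2*m+1)" if "\<sigma> \<in> {\<sigma>. \<sigma> permutes {..<?n} \<and> \<sigma> (2*m+2) = 2*m+2}"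
        using that permutes_compose[OF r, of \<sigma>]
        by (simp only: mem_Collect_eq o_apply transpose_apply_first transpose_apply_second)
    qed
    also have "{\<sigma>. \<sigma> permutes {..<?n} \<and> \<sigma> (2*m+2) = 2*m+2} = {\<sigma>. \<sigma> permutes {..<2*m+2}}"
      using permutes_Suc_fixing_last[of "2*m+2"] by (simp add: numeral_3_eq_3)
    also have "(\<Sum>\<sigma> | \<sigma> permutes {..<2*m+2}. ?g (\<sigma> \<circ> ?r)) = (\<Sum>\<sigma> | \<sigma> permutes {..<2*m+2}.
      - (signed_pair_prod m w \<sigma> * w (\<sigma> (2*m)) (2*m+2) * w (\<sigma> (2*m+1)) (2*m+3)))"
    proof (rule sum.cong[OF refl], clarify)
      fix \<sigma> :: "nat \<Rightarrow> nat" assume \<sigma>: "\<sigma> permutes {..<2*m+2}"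
      have fixed: "\<sigma> (2*m+2) = 2*m+2" using permutes_not_in[OF \<sigma>] by simp
      have r_low: "?r i = i" if "i < 2*m+1" for i
        using that by (intro transpose_apply_other) auto
      have "permutation \<sigma>" using \<sigma> permutation_permutes by (metis finite_lessThan)
      then have "sign (\<sigma> \<circ> ?r) = sign \<sigma> * sign ?r" by (intro sign_compose permutation_swap_id)
      also have "sign ?r = - 1" by (simp add: sign_swap_id)
      finally have sign: "sign (\<sigma> \<circ> ?r) = - sign \<sigma>" by (simp only: mult_minus1_right)
      have "pair_prod m w (\<sigma> \<circ> ?r) = pair_prod m w \<sigma>"
        unfolding pair_prod_def by (rule prod.cong[OF refl]) (simp add: r_low)
      moreover have "pair_prod (m+1) w (\<sigma> \<circ> ?r) = pair_prod m w (\<sigma> \<circ> ?r) * w (\<sigma> (2*m)) (2*m+2)"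
      proof -
        have "(\<sigma> \<circ> ?r) (2*m) = \<sigma> (2*m)" "(\<sigma> \<circ> ?r) (2*m+1) = 2*m+2"
          using fixed r_low[of "2*m"] by (simp_all only: o_apply transpose_apply_first)
        then show ?thesis unfolding pair_prod_def by (simp only: prod.lessThan_Suc Suc_eq_plus1[symmetric])
      qed
      moreover have "(\<sigma> \<circ> ?r) (2*m+2) = \<sigma> (2*m+1)" by (simp only: o_apply transpose_apply_second)
      ultimately show "?g (\<sigma> \<circ> ?r) = - (signed_pair_prod m w \<sigma> * w (\<sigma> (2*m)) (2*m+2) * w (\<sigma> (2*m+1)) (2*m+3))"
        unfolding signed_pair_prod_def sign by (simp only: of_int_minus mult_minus_left mult.assoc)
    qed
    also have "\<dots> = - ?R" by (rule sum_negf)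
    finally show ?thesis .
  qed
  have "(\<Sum>\<sigma> | \<sigma> permutes {..<?n}. ?g \<sigma>) = (\<Sum>b<?n. sum ?g (?at b))"
    by (rule sum_permutes_split_position) simp
  also have "\<dots> = (\<Sum>b<2*m+2. sum ?g (?at b)) + sum ?g (?at (2*m+2))"
  proof -
    have "{..<?n} = insert (2*m+2) {..<2*m+2}" by auto
    then show ?thesis by (simp only: sum.insert finite_lessThan lessThan_iff less_irrefl not_False_eq_True add.commute)
  qed
  also have "(\<Sum>b<2*m+2. sum ?g (?at b)) = (\<Sum>b<2*m+2. sum ?g (?at (2*m+1)))"
    by (rule sum.cong[OF refl], rule move) simp
  also have "\<dots> = of_nat (2*m+2) * sum ?g (?at (2*m+1))" by (simp only: sum_constant card_lessThan)
  finally have "(\<Sum>\<sigma> | \<sigma> permutes {..<?n}. ?g \<sigma>) =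
      (\<Sum>\<sigma> | \<sigma> permutes {..<2*m+2}. signed_pair_prod (m+1) w \<sigma>) * w (2*m+2) (2*m+3)
      - of_nat (2*m+2) * (\<Sum>\<sigma> | \<sigma> permutes {..<2*m+2}.
          signed_pair_prod m w \<sigma> * w (\<sigma> (2*m)) (2*m+2) * w (\<sigma> (2*m+1)) (2*m+3))"
    unfolding last inner by simp
  moreover have "2*(m+1)+2 = 2*m+4" "2*(m+1)+1 = 2*m+3" "m+1+1 = m+2" "2*(m+1) = 2*m+2" by simp_all
  ultimately show ?thesis using sum_signed_pair_prod_fix_last[of "m+1" w] assms by (simp only:)
qed

section \<open>Lebesgue measure on finite powers of the line\<close>

abbreviation lborel_power :: "nat set \<Rightarrow> (nat \<Rightarrow> real) measure" where
  "lborel_power I \<equiv> \<Pi>\<^sub>M i\<in>I. lborel"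

interpretation lborel_product: product_sigma_finite "\<lambda>_::nat. lborel :: real measure" ..

text \<open>
  It suffices to compare the measures of boxes, which are products over the coordinates in any order.
\<close>

lemma distr_lborel_power_reindex:
  assumes t: "bij_betw t I J" and fin: "finite I"
  shows "distr (lborel_power J) (lborel_power I) (\<lambda>x. \<lambda>i\<in>I. x (t i)) = lborel_power I"
proof (rule lborel_product.PiM_eqI[OF fin])
  have finJ: "finite J" using t fin bij_betw_finite by blast
  have tJ: "t i \<in> J" if "i \<in> I" for i using t that bij_betwE by blast
  have meas: "(\<lambda>x. \<lambda>i\<in>I. x (t i)) \<in> measurable (lborel_power J) (lborel_power I)"
    using tJ by (intro measurable_restrict measurable_component_singleton)
  fix A :: "nat \<Rightarrow> real set" assume A: "\<And>i. i \<in> I \<Longrightarrow> A i \<in> sets lborel"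
  let ?s = "the_inv_into I t"
  have s: "?s j \<in> I" "t (?s j) = j" if "j \<in> J" for j
    using t that by (auto simp: bij_betw_def the_inv_into_into f_the_inv_into_f)
  have st: "?s (t i) = i" if "i \<in> I" for i
    using t that by (auto simp: bij_betw_def the_inv_into_f_f)
  have "emeasure (distr (lborel_power J) (lborel_power I) (\<lambda>x. \<lambda>i\<in>I. x (t i))) (Pi\<^sub>E I A) =
      emeasure (lborel_power J) ((\<lambda>x. \<lambda>i\<in>I. x (t i)) -` Pi\<^sub>E I A \<inter> space (lborel_power J))"
    using A fin by (intro emeasure_distr[OF meas] sets_PiM_I_finite)
  also have "(\<lambda>x. \<lambda>i\<in>I. x (t i)) -` Pi\<^sub>E I A \<inter> space (lborel_power J) = (\<Pi>\<^sub>E j\<in>J. A (?s j))"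
  proof (intro Set.set_eqI iffI)
    fix x assume "x \<in> (\<lambda>x. \<lambda>i\<in>I. x (t i)) -` Pi\<^sub>E I A \<inter> space (lborel_power J)"
    then have x: "\<And>i. i \<in> I \<Longrightarrow> x (t i) \<in> A i" "x \<in> extensional J"
      by (auto simp: space_PiM PiE_iff)
    have "x j \<in> A (?s j)" if "j \<in> J" for j using x(1)[OF s(1)[OF that]] s(2)[OF that] by simp
    then show "x \<in> (\<Pi>\<^sub>E j\<in>J. A (?s j))" using x(2) by (simp add: PiE_iff)
  next
    fix x assume x: "x \<in> (\<Pi>\<^sub>E j\<in>J. A (?s j))"
    have "x (t i) \<in> A i" if "i \<in> I" for i
      using PiE_mem[OF x tJ[OF that]] st[OF that] by simp
    then show "x \<in> (\<lambda>x. \<lambda>i\<in>I. x (t i)) -` Pi\<^sub>E I A \<inter> space (lborel_power J)"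
      using x by (auto simp: space_PiM PiE_iff)
  qed
  also have "emeasure (lborel_power J) (\<Pi>\<^sub>E j\<in>J. A (?s j)) = (\<Prod>j\<in>J. emeasure lborel (A (?s j)))"
    using A s by (intro lborel_product.emeasure_PiM finJ) auto
  also have "\<dots> = (\<Prod>i\<in>I. emeasure lborel (A i))"
    by (subst prod.reindex_bij_betw[OF t, symmetric]) (rule prod.cong, simp_all add: st)
  finally show "emeasure (distr (lborel_power J) (lborel_power I) (\<lambda>x. \<lambda>i\<in>I. x (t i))) (Pi\<^sub>E I A) =
      (\<Prod>i\<in>I. emeasure lborel (A i))" .
qed simp

lemma integral_lborel_power_reindex:
  fixes f :: "(nat \<Rightarrow> real) \<Rightarrow> 'a::{banach, second_countable_topology}"
  assumes t: "bij_betw t I J" and fin: "finite I" and f: "f \<in> borel_measurable (lborel_power I)"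
  shows "(LINT x|lborel_power J. f (\<lambda>i\<in>I. x (t i))) = (LINT x|lborel_power I. f x)"
proof -
  have tJ: "t i \<in> J" if "i \<in> I" for i using t that bij_betwE by blast
  have "(\<lambda>x. \<lambda>i\<in>I. x (t i)) \<in> measurable (lborel_power J) (lborel_power I)"
    using tJ by (intro measurable_restrict measurable_component_singleton)
  from integral_distr[OF this f] show ?thesis unfolding distr_lborel_power_reindex[OF t fin] by simp
qed

lemma integral_pair_mult:
  fixes f :: "'a \<Rightarrow> complex" and g :: "'b \<Rightarrow> complex"
  assumes "sigma_finite_measure M" "sigma_finite_measure N" "integrable M f" "integrable N g"
  shows "integrable (M \<Otimes>\<^sub>M N) (\<lambda>z. f (fst z) * g (snd z))"
    and "(LINT z|(M \<Otimes>\<^sub>M N). f (fst z) * g (snd z)) = integral\<^sup>L M f * integral\<^sup>L N g"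
proof -
  interpret pair_sigma_finite M N using assms(1,2) by (rule pair_sigma_finite.intro)
  have [measurable]: "f \<in> borel_measurable M" "g \<in> borel_measurable N" using assms by auto
  show int: "integrable (M \<Otimes>\<^sub>M N) (\<lambda>z. f (fst z) * g (snd z))"
  proof (rule Fubini_integrable)
    show "integrable M (\<lambda>x. LINT y|N. norm (f (fst (x, y)) * g (snd (x, y))))"
      using assms(3) by (simp add: norm_mult)
    show "AE x in M. integrable N (\<lambda>y. f (fst (x, y)) * g (snd (x, y)))"
      using assms(4) by simp
  qed measurable
  show "(LINT z|(M \<Otimes>\<^sub>M N). f (fst z) * g (snd z)) = integral\<^sup>L M f * integral\<^sup>L N g"
    by (subst integral_fst'[OF int, symmetric]) simp
qed

lemma distr_lborel_power_insert:
  assumes "finite I" "a \<notin> I"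
  shows "distr (lborel_power I \<Otimes>\<^sub>M lborel) (lborel_power (insert a I)) (\<lambda>z. (fst z)(a := snd z)) =
    lborel_power (insert a I)"
proof (rule lborel_product.PiM_eqI)
  have meas: "(\<lambda>z. (fst z)(a := snd z)) \<in> measurable (lborel_power I \<Otimes>\<^sub>M lborel) (lborel_power (insert a I))"
    by (rule measurable_fun_upd[of _ I]) auto
  fix A :: "nat \<Rightarrow> real set" assume A: "\<And>i. i \<in> insert a I \<Longrightarrow> A i \<in> sets lborel"
  interpret S: sigma_finite_measure "lborel_power I" by (rule lborel_product.sigma_finite[OF assms(1)])
  have "emeasure (distr (lborel_power I \<Otimes>\<^sub>M lborel) (lborel_power (insert a I)) (\<lambda>z. (fst z)(a := snd z)))
      (Pi\<^sub>E (insert a I) A) = emeasure (lborel_power I \<Otimes>\<^sub>M lborel)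
      ((\<lambda>z. (fst z)(a := snd z)) -` Pi\<^sub>E (insert a I) A \<inter> space (lborel_power I \<Otimes>\<^sub>M lborel))"
    using A assms by (intro emeasure_distr[OF meas] sets_PiM_I_finite) auto
  also have "(\<lambda>z. (fst z)(a := snd z)) -` Pi\<^sub>E (insert a I) A \<inter> space (lborel_power I \<Otimes>\<^sub>M lborel) =
      Pi\<^sub>E I A \<times> A a"
    using assms(2) by (fastforce simp: space_pair_measure space_PiM PiE_iff extensional_def split: if_splits)
  also have "emeasure (lborel_power I \<Otimes>\<^sub>M lborel) (Pi\<^sub>E I A \<times> A a) = emeasure (lborel_power I) (Pi\<^sub>E I A) * emeasure lborel (A a)"
    using A assms by (intro lborel.emeasure_pair_measure_Times sets_PiM_I_finite) auto
  also have "emeasure (lborel_power I) (Pi\<^sub>E I A) = (\<Prod>i\<in>I. emeasure lborel (A i))"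
    using A assms by (intro lborel_product.emeasure_PiM) auto
  finally show "emeasure (distr (lborel_power I \<Otimes>\<^sub>M lborel) (lborel_power (insert a I)) (\<lambda>z. (fst z)(a := snd z)))
      (Pi\<^sub>E (insert a I) A) = (\<Prod>i\<in>insert a I. emeasure lborel (A i))"
    by (simp only: prod.insert[OF assms] mult.commute)
qed (use assms in simp_all)

lemma AE_lborel_power_neq:
  assumes "finite I" "a \<in> I" "b \<in> I" "a \<noteq> b"
  shows "AE x in lborel_power I. x a \<noteq> x b"
proof -
  define K where "K = I - {a}"
  have K: "finite K" "a \<notin> K" "b \<in> K" "I = insert a K" using assms unfolding K_def by auto
  interpret pair_sigma_finite "lborel_power K" "lborel :: real measure"
    by (intro pair_sigma_finite.intro lborel_product.sigma_finite[OF K(1)] lborel.sigma_finite_measure_axioms)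
  have meas: "(\<lambda>z. (fst z)(a := snd z)) \<in> measurable (lborel_power K \<Otimes>\<^sub>M lborel) (lborel_power I)"
    unfolding K(4) by (rule measurable_fun_upd[of _ K]) auto
  have pred: "{x \<in> space (lborel_power I). x a \<noteq> x b} \<in> sets (lborel_power I)"
    by (intro sets.sets_Collect_neg borel_measurable_eq[of _ "lborel_power I"]
        measurable_component_singleton[of a I "\<lambda>_. lborel", simplified]
        measurable_component_singleton[of b I "\<lambda>_. lborel", simplified]) (use assms in simp_all)
  have "AE z in lborel_power K \<Otimes>\<^sub>M lborel. snd z \<noteq> fst z b"
  proof (rule AE_pair_measure)
    show "{z \<in> space (lborel_power K \<Otimes>\<^sub>M lborel). snd z \<noteq> fst z b} \<in> sets (lborel_power K \<Otimes>\<^sub>M lborel)"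
    proof -
      have "(\<lambda>z. snd z) \<in> borel_measurable (lborel_power K \<Otimes>\<^sub>M lborel)" by simp
      moreover have "(\<lambda>z. fst z b) \<in> borel_measurable (lborel_power K \<Otimes>\<^sub>M lborel)"
        by (rule measurable_compose[OF measurable_fst])
           (use measurable_component_singleton[OF K(3), of "\<lambda>_. lborel :: real measure"] in simp)
      ultimately show ?thesis by measurable
    qed
    show "AE x in lborel_power K. AE y in lborel. snd (x, y) \<noteq> fst (x, y) b"
      by (simp add: AE_lborel_singleton)
  qed
  then have "AE z in lborel_power K \<Otimes>\<^sub>M lborel. ((fst z)(a := snd z)) a \<noteq> ((fst z)(a := snd z)) b"
    using assms(4) by simp
  then have "AE x in distr (lborel_power K \<Otimes>\<^sub>M lborel) (lborel_power I) (\<lambda>z. (fst z)(a := snd z)). x a \<noteq> x b"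
    using AE_distr_iff[OF meas pred] by simp
  then show ?thesis unfolding K(4) distr_lborel_power_insert[OF K(1,2)] .
qed

lemma AE_lborel_power_inj_on:
  assumes "finite I"
  shows "AE x in lborel_power I. inj_on x I"
proof -
  have "AE x in lborel_power I. \<forall>p\<in>{p \<in> I \<times> I. fst p \<noteq> snd p}. x (fst p) \<noteq> x (snd p)"
    using assms by (intro AE_finite_allI) (auto intro: AE_lborel_power_neq)
  then show ?thesis by (rule AE_mp) (auto simp: inj_on_def intro!: AE_I2)
qed

lemma integral_lborel_power_insert_mult:
  fixes F :: "(nat \<Rightarrow> real) \<Rightarrow> complex" and k :: "real \<Rightarrow> complex"
  assumes "finite I" "a \<notin> I" "integrable (lborel_power I) F" "integrable lborel k"
    and F: "\<And>x u. F (x(a := u)) = F x" "F \<in> borel_measurable (lborel_power (insert a I))"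
  shows "(LINT x|lborel_power (insert a I). F x * k (x a)) = integral\<^sup>L (lborel_power I) F * integral\<^sup>L lborel k"
proof -
  have meas: "(\<lambda>z. (fst z)(a := snd z)) \<in> measurable (lborel_power I \<Otimes>\<^sub>M lborel) (lborel_power (insert a I))"
    by (rule measurable_fun_upd[of _ I]) auto
  have [measurable]: "k \<in> borel_measurable borel" using assms(4) by auto
  have f: "(\<lambda>x. F x * k (x a)) \<in> borel_measurable (lborel_power (insert a I))"
    using F(2) by measurable
  note S = lborel_product.sigma_finite[OF assms(1)] lborel.sigma_finite_measure_axioms
  have "(LINT x|distr (lborel_power I \<Otimes>\<^sub>M lborel) (lborel_power (insert a I)) (\<lambda>z. (fst z)(a := snd z)).
      F x * k (x a)) = integral\<^sup>L (lborel_power I) F * integral\<^sup>L lborel k"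
    using integral_pair_mult(2)[OF S assms(3,4)] by (subst integral_distr[OF meas f]) (simp add: F(1))
  then show "(LINT x|lborel_power (insert a I). F x * k (x a)) = integral\<^sup>L (lborel_power I) F * integral\<^sup>L lborel k"
    by (simp only: distr_lborel_power_insert[OF assms(1,2)])
qed

section \<open>Decomposition into ordered chambers\<close>

text \<open>
  The inverse of the sorting permutation is the rank, which counts the smaller entries.
\<close>

lemma ex1_sorting_permutation:
  fixes x :: "nat \<Rightarrow> 'a::linorder"
  assumes "inj_on x {..<n}"
  shows "\<exists>!\<sigma>. \<sigma> permutes {..<n} \<and> strict_mono_on {..<n} (x \<circ> \<sigma>)"
proof -
  define rank where "rank i = (if i < n then card {j. j < n \<and> x j < x i} else i)" for i
  have rank_less: "rank i < rank j" if "i < n" "j < n" "x i < x j" for i j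
  proof -
    have "{k. k < n \<and> x k < x i} \<subset> {k. k < n \<and> x k < x j}" using that by auto
    then show ?thesis using that unfolding rank_def by (simp add: psubset_card_mono)
  qed
  have rank_lt: "rank i < n" if "i < n" for i
  proof -
    have "{k. k < n \<and> x k < x i} \<subset> {..<n}" using that by auto
    from psubset_card_mono[OF _ this] show ?thesis using that unfolding rank_def by simp
  qed
  have rank_less_iff: "rank i < rank j \<longleftrightarrow> x i < x j" if "i < n" "j < n" for i j
  proof (cases "x i" "x j" rule: linorder_cases)
    case equal
    then show ?thesis using that by (simp add: rank_def)
  qed (use rank_less[of i j] rank_less[of j i] that in simp_all)
  have "inj_on rank {..<n}"
  proof (rule inj_onI)
    fix i j assume ij: "i \<in> {..<n}" "j \<in> {..<n}" "rank i = rank j"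
    then have "\<not> x i < x j" "\<not> x j < x i" using rank_less[of i j] rank_less[of j i] by auto
    then have "x i = x j" by simp
    then show "i = j" using inj_onD[OF assms] ij by blast
  qed
  then have "bij_betw rank {..<n} {..<n}"
    unfolding bij_betw_def using rank_lt by (intro conjI endo_inj_surj) auto
  then have rank: "rank permutes {..<n}" by (rule bij_imp_permutes) (simp add: rank_def)
  show ?thesis
  proof
    show "inv_fun rank permutes {..<n} \<and> strict_mono_on {..<n} (x \<circ> inv_fun rank)"
    proof
      show inv: "inv_fun rank permutes {..<n}" by (rule permutes_inv[OF rank])
      show "strict_mono_on {..<n} (x \<circ> inv_fun rank)"
      proof (rule strict_mono_onI)
        fix i j assume ij: "i \<in> {..<n}" "j \<in> {..<n}" "i < j"
        have "inv_fun rank i < n" "inv_fun rank j < n"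
          using permutes_in_image[OF inv, of i] permutes_in_image[OF inv, of j] ij by simp_all
        from rank_less_iff[OF this] ij show "(x \<circ> inv_fun rank) i < (x \<circ> inv_fun rank) j"
          by (simp add: permutes_inverses[OF rank])
      qed
    qed
  next
    fix \<sigma> assume \<sigma>: "\<sigma> permutes {..<n} \<and> strict_mono_on {..<n} (x \<circ> \<sigma>)"
    have "(rank \<circ> \<sigma>) i = i" if "i < n" for i
    proof (rule strict_mono_below_self[OF _ _ that])
      fix k l :: nat assume kl: "k < l" "l < n"
      then have "x (\<sigma> k) < x (\<sigma> l)" using strict_mono_onD[of "{..<n}" "x \<circ> \<sigma>" k l] \<sigma> by simp
      then show "(rank \<circ> \<sigma>) k < (rank \<circ> \<sigma>) l"
        using permutes_in_image[of \<sigma> "{..<n}" k] permutes_in_image[of \<sigma> "{..<n}" l] \<sigma> kl by (simp add: rank_less)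
    next
      fix k assume "k < n"
      then show "(rank \<circ> \<sigma>) k < n" using permutes_in_image[of \<sigma> "{..<n}" k] \<sigma> by (simp add: rank_lt)
    qed
    then have "\<sigma> i = inv_fun rank i" if "i < n" for i
      using that permutes_inverses(2)[OF rank, of "\<sigma> i"] by simp
    moreover have "\<sigma> i = inv_fun rank i" if "\<not> i < n" for i
      using that permutes_not_in[of \<sigma> "{..<n}" i] \<sigma> permutes_not_in[OF permutes_inv[OF rank], of i] by simp
    ultimately show "\<sigma> = inv_fun rank" by blast
  qed
qed

text \<open>
  Indices are given by a function, so that permutations can be inserted as they are.
\<close>

definition chamber_integral :: "(nat \<Rightarrow> real \<Rightarrow> complex) \<Rightarrow> nat \<Rightarrow> (nat \<Rightarrow> nat) \<Rightarrow> complex" where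
  "chamber_integral g n i =
    (LINT x|lborel_power {..<n}. indicator {x. strict_mono_on {..<n} x} x * (\<Prod>k<n. g (i k) (x k)))"

definition pair_integral :: "(nat \<Rightarrow> real \<Rightarrow> complex) \<Rightarrow> nat \<Rightarrow> nat \<Rightarrow> complex" where
  "pair_integral g i j = (LINT z|(lborel \<Otimes>\<^sub>M lborel). order_sign (fst z) (snd z) * g i (fst z) * g j (snd z))"

lemma measurable_order_sign [measurable (raw)]:
  fixes f g :: "'a \<Rightarrow> real"
  assumes [measurable]: "f \<in> borel_measurable M" "g \<in> borel_measurable M"
  shows "(\<lambda>x. order_sign (f x) (g x)) \<in> borel_measurable M"
  unfolding order_sign_def by measurable

lemma measurable_lborel_power_component:
  "k \<in> I \<Longrightarrow> (\<lambda>x. x k) \<in> borel_measurable (lborel_power I)"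
  using measurable_component_singleton[of k I "\<lambda>_. lborel :: real measure"] by simp

lemma sets_chamber: "{x \<in> space (lborel_power {..<n}). strict_mono_on {..<n} x} \<in> sets (lborel_power {..<n})"
proof -
  have "{x \<in> space (lborel_power {..<n}). strict_mono_on {..<n} x} =
      {x \<in> space (lborel_power {..<n}). \<forall>p\<in>{p\<in>{..<n} \<times> {..<n}. fst p < snd p}. x (fst p) < x (snd p)}"
    unfolding strict_mono_on_def by auto
  also have "\<dots> \<in> sets (lborel_power {..<n})"
    by (intro sets.sets_Collect_finite_All borel_measurable_less measurable_lborel_power_component) auto
  finally show ?thesis .
qed

lemma measurable_indicator_chamber:
  "indicator {x. strict_mono_on {..<n} x} \<in> borel_measurable (lborel_power {..<n})"
  using sets_chamber[of n] by (subst measurable_cong[of _ _ "indicator {x \<in> space (lborel_power {..<n}). strict_mono_on {..<n} x}"])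
    (auto simp: indicator_def)

lemma norm_order_sign_le: "norm (order_sign x y) \<le> 1"
  by (simp add: order_sign_def)

text \<open>
  Existence of the sorting permutation says that the permuted chambers cover the points with distinct
  coordinates, uniqueness that they are disjoint.
\<close>

lemma sum_chamber_indicators:
  fixes x :: "nat \<Rightarrow> real"
  assumes "inj_on x {..<n}"
  shows "(\<Sum>\<sigma> | \<sigma> permutes {..<n}. indicator {y. strict_mono_on {..<n} y} (x \<circ> \<sigma>)) = (1 :: complex)"
proof -
  obtain \<rho> where \<rho>: "\<rho> permutes {..<n}" "strict_mono_on {..<n} (x \<circ> \<rho>)"
    and unique: "\<And>\<sigma>. \<sigma> permutes {..<n} \<Longrightarrow> strict_mono_on {..<n} (x \<circ> \<sigma>) \<Longrightarrow> \<sigma> = \<rho>"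
    using ex1_sorting_permutation[OF assms] by blast
  have "(\<Sum>\<sigma> | \<sigma> permutes {..<n}. indicator {y. strict_mono_on {..<n} y} (x \<circ> \<sigma>)) =
      (\<Sum>\<sigma> | \<sigma> permutes {..<n}. if \<sigma> = \<rho> then 1 else 0 :: complex)"
  proof (rule sum.cong[OF refl], clarify)
    fix \<sigma> assume "\<sigma> permutes {..<n}"
    then have "strict_mono_on {..<n} (x \<circ> \<sigma>) \<longleftrightarrow> \<sigma> = \<rho>" using unique \<rho>(2) by blast
    then show "indicator {y. strict_mono_on {..<n} y} (x \<circ> \<sigma>) = (if \<sigma> = \<rho> then 1 else 0 :: complex)"
      by (simp only: indicator_def mem_Collect_eq of_bool_def)
  qed
  also have "\<dots> = 1" using \<rho>(1) by (simp add: finite_permutations)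
  finally show ?thesis .
qed

text \<open>
  On the increasing chamber the signs depend on the indices only, which is why they can be taken out
  of the integral.
\<close>

lemma order_sign_strict_mono:
  assumes "strict_mono_on {..<n} y" "a < n" "b < n"
  shows "order_sign (y a) (y b) = order_sign a b"
proof (cases a b rule: linorder_cases)
  case less
  then have "y a < y b" using strict_mono_onD[OF assms(1), of a b] assms by simp
  then show ?thesis using less by (simp add: order_sign_def)
next
  case greater
  then have "y b < y a" using strict_mono_onD[OF assms(1), of b a] assms by simp
  then show ?thesis using greater by (simp add: order_sign_def not_less less_imp_le)
qed (simp add: order_sign_def)

text \<open>
  Consecutive coordinates are coupled by the kernel; for odd \<open>n\<close> the last one is left free, which
  produces a single integral in place of a double one.
\<close>

definition paired_integrand :: "(nat \<Rightarrow> real \<Rightarrow> complex) \<Rightarrow> nat \<Rightarrow> (nat \<Rightarrow> nat) \<Rightarrow> (nat \<Rightarrow> real) \<Rightarrow> complex" where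
  "paired_integrand g n i x =
    (\<Prod>k<n. g (i k) (x k)) * (\<Prod>k<n div 2. order_sign (x (2*k)) (x (2*k+1)))"

lemma two_mult_less_of_less_div_two:
  "k < n div 2 \<Longrightarrow> 2*k < n" "k < n div 2 \<Longrightarrow> 2*k+1 < (n :: nat)"
  by linarith+

lemma paired_integrand_cong:
  assumes "\<And>k. k < n \<Longrightarrow> x k = y k"
  shows "paired_integrand g n i x = paired_integrand g n i y"
proof -
  have "(\<Prod>k<n. g (i k) (x k)) = (\<Prod>k<n. g (i k) (y k))"
    by (rule prod.cong) (simp_all add: assms)
  moreover have "(\<Prod>k<n div 2. order_sign (x (2*k)) (x (2*k+1))) = (\<Prod>k<n div 2. order_sign (y (2*k)) (y (2*k+1)))"
    by (rule prod.cong[OF refl]) (simp only: lessThan_iff assms two_mult_less_of_less_div_two)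
  ultimately show ?thesis unfolding paired_integrand_def by (simp only:)
qed

lemma measurable_paired_integrand:
  assumes "\<And>j. g j \<in> borel_measurable borel" "{..<n} \<subseteq> I"
  shows "paired_integrand g n i \<in> borel_measurable (lborel_power I)"
  unfolding paired_integrand_def
  using two_mult_less_of_less_div_two[of _ n] assms(2)
  by (intro borel_measurable_times borel_measurable_prod measurable_order_sign measurable_lborel_power_component
      measurable_compose[OF measurable_lborel_power_component assms(1)]) auto

lemma integrable_paired_integrand:
  assumes "\<And>j. integrable lborel (g j)"
  shows "integrable (lborel_power {..<n}) (paired_integrand g n i)"
proof (rule Bochner_Integration.integrable_bound)
  show "integrable (lborel_power {..<n}) (\<lambda>x. \<Prod>k<n. g (i k) (x k))"
    using lborel_product.product_integrable_prod[of "{..<n}" "\<lambda>k. g (i k)"] assms by simp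
  have "g j \<in> borel_measurable borel" for j using borel_measurable_integrable[OF assms[of j]] by simp
  then show "paired_integrand g n i \<in> borel_measurable (lborel_power {..<n})"
    by (intro measurable_paired_integrand) auto
  have "norm (\<Prod>k<n div 2. order_sign (x (2*k)) (x (2*k+1))) \<le> 1" for x :: "nat \<Rightarrow> real"
    unfolding prod_norm[symmetric] by (intro prod_le_1) (simp add: norm_order_sign_le)
  then show "AE x in lborel_power {..<n}. norm (paired_integrand g n i x) \<le> norm (\<Prod>k<n. g (i k) (x k))"
    unfolding paired_integrand_def norm_mult by (intro AE_I2 mult_left_le) simp_all
qed

text \<open>
  Almost every point has distinct coordinates and lies in one chamber. Renaming the coordinates
  maps that chamber to the increasing one, where the kernels become the constants
  \<open>pair_prod (n div 2) order_sign \<tau>\<close> and the renaming passes to the indices of the functions.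
\<close>

theorem integral_paired_integrand_chambers:
  assumes g: "\<And>j. integrable lborel (g j)"
  shows "(LINT x|lborel_power {..<n}. paired_integrand g n i x) =
    (\<Sum>\<tau> | \<tau> permutes {..<n}. pair_prod (n div 2) order_sign \<tau> * chamber_integral g n (i \<circ> inv_fun \<tau>))"
proof -
  let ?M = "lborel_power {..<n}"
  let ?S = "{\<sigma> :: nat \<Rightarrow> nat. \<sigma> permutes {..<n}}"
  let ?F = "paired_integrand g n i" and ?ind = "indicator {x. strict_mono_on {..<n} x} :: (nat \<Rightarrow> real) \<Rightarrow> complex"
  \<comment> \<open>The part of the integrand on the chamber sorted by \<open>\<sigma>\<close>, in the sorted coordinates.\<close>
  define \<Phi> where "\<Phi> \<sigma> y = ?ind y * ?F (y \<circ> inv_fun \<sigma>)" for \<sigma> y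
  have gm: "g j \<in> borel_measurable borel" for j using borel_measurable_integrable[OF g[of j]] by simp
  have Fm: "?F \<in> borel_measurable ?M" by (rule measurable_paired_integrand[OF gm order_refl])
  have reindex: "\<Phi> \<sigma> (\<lambda>k\<in>{..<n}. x (\<sigma> k)) = ?ind (x \<circ> \<sigma>) * ?F x" if "\<sigma> permutes {..<n}" for \<sigma> x
  proof -
    have "strict_mono_on {..<n} (\<lambda>k\<in>{..<n}. x (\<sigma> k)) \<longleftrightarrow> strict_mono_on {..<n} (x \<circ> \<sigma>)"
      unfolding strict_mono_on_def by simp
    then have "?ind (\<lambda>k\<in>{..<n}. x (\<sigma> k)) = ?ind (x \<circ> \<sigma>)"
      by (simp only: indicator_def mem_Collect_eq)
    moreover have "?F ((\<lambda>k\<in>{..<n}. x (\<sigma> k)) \<circ> inv_fun \<sigma>) = ?F x"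
    proof (rule paired_integrand_cong)
      fix k assume "k < n"
      then have "inv_fun \<sigma> k < n" using permutes_in_image[OF permutes_inv[OF that], of k] by simp
      then show "((\<lambda>k\<in>{..<n}. x (\<sigma> k)) \<circ> inv_fun \<sigma>) k = x k" by (simp add: permutes_inverses[OF that])
    qed
    ultimately show ?thesis unfolding \<Phi>_def by (simp only:)
  qed
  have \<Phi>_eq: "\<Phi> \<sigma> y = pair_prod (n div 2) order_sign (inv_fun \<sigma>) * (?ind y * (\<Prod>k<n. g ((i \<circ> \<sigma>) k) (y k)))"
    if "\<sigma> permutes {..<n}" for \<sigma> y
  proof (cases "strict_mono_on {..<n} y")
    case True
    have "(\<Prod>k<n div 2. order_sign ((y \<circ> inv_fun \<sigma>) (2*k)) ((y \<circ> inv_fun \<sigma>) (2*k+1))) =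
        pair_prod (n div 2) order_sign (inv_fun \<sigma>)"
      unfolding pair_prod_def o_apply
    proof (rule prod.cong[OF refl])
      fix k assume "k \<in> {..<n div 2}"
      then have "2*k \<in> {..<n}" "2*k+1 \<in> {..<n}" by auto
      then have "inv_fun \<sigma> (2*k) < n" "inv_fun \<sigma> (2*k+1) < n"
        using permutes_in_image[OF permutes_inv[OF that]] by blast+
      then show "order_sign (y (inv_fun \<sigma> (2*k))) (y (inv_fun \<sigma> (2*k+1))) = order_sign (inv_fun \<sigma> (2*k)) (inv_fun \<sigma> (2*k+1))"
        by (rule order_sign_strict_mono[OF True])
    qed
    moreover have "(\<Prod>k<n. g (i k) ((y \<circ> inv_fun \<sigma>) k)) = (\<Prod>k<n. g ((i \<circ> \<sigma>) k) (y k))"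
      using prod.reindex_bij_betw[OF permutes_imp_bij[OF that], of "\<lambda>k. g (i k) ((y \<circ> inv_fun \<sigma>) k)"]
      by (simp add: permutes_inverses[OF that])
    ultimately show ?thesis unfolding \<Phi>_def paired_integrand_def by (simp only: mult_ac)
  qed (simp add: \<Phi>_def)
  have chamber_meas: "(\<lambda>y. ?ind y * (\<Prod>k<n. g (j k) (y k))) \<in> borel_measurable ?M" for j
    by (intro borel_measurable_times measurable_indicator_chamber borel_measurable_prod
        measurable_compose[OF measurable_lborel_power_component gm])
  have \<Phi>_meas: "\<Phi> \<sigma> \<in> borel_measurable ?M" if "\<sigma> permutes {..<n}" for \<sigma>
    unfolding \<Phi>_eq[OF that, abs_def] by (rule borel_measurable_times[OF borel_measurable_const chamber_meas])
  have summand: "(LINT x|?M. ?ind (x \<circ> \<sigma>) * ?F x) =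
      pair_prod (n div 2) order_sign (inv_fun \<sigma>) * chamber_integral g n (i \<circ> \<sigma>)" if "\<sigma> permutes {..<n}" for \<sigma>
  proof -
    have "(LINT x|?M. ?ind (x \<circ> \<sigma>) * ?F x) = (LINT x|?M. \<Phi> \<sigma> (\<lambda>k\<in>{..<n}. x (\<sigma> k)))"
      by (simp only: reindex[OF that])
    also have "\<dots> = (LINT x|?M. \<Phi> \<sigma> x)"
      by (rule integral_lborel_power_reindex[OF permutes_imp_bij[OF that] _ \<Phi>_meas[OF that]]) simp
    also have "\<dots> = pair_prod (n div 2) order_sign (inv_fun \<sigma>) * chamber_integral g n (i \<circ> \<sigma>)"
      unfolding \<Phi>_eq[OF that] chamber_integral_def by (rule integral_mult_right_zero)
    finally show ?thesis .
  qed
  have int: "integrable ?M (\<lambda>x. ?ind (x \<circ> \<sigma>) * ?F x)" if "\<sigma> permutes {..<n}" for \<sigma>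
  proof (rule Bochner_Integration.integrable_bound[OF integrable_paired_integrand[OF g]])
    have "(\<lambda>x. \<lambda>k\<in>{..<n}. x (\<sigma> k)) \<in> measurable ?M ?M"
      using permutes_in_image[OF that] by (intro measurable_restrict measurable_component_singleton) simp
    from measurable_compose[OF this \<Phi>_meas[OF that]]
    show "(\<lambda>x. ?ind (x \<circ> \<sigma>) * ?F x) \<in> borel_measurable ?M" unfolding reindex[OF that] .
    show "AE x in ?M. norm (?ind (x \<circ> \<sigma>) * ?F x) \<le> norm (?F x)"
      by (intro AE_I2) (simp add: norm_mult indicator_def)
  qed
  have "(LINT x|?M. ?F x) = (LINT x|?M. (\<Sum>\<sigma>\<in>?S. ?ind (x \<circ> \<sigma>) * ?F x))"
  proof (rule integral_cong_AE)
    show "AE x in ?M. ?F x = (\<Sum>\<sigma>\<in>?S. ?ind (x \<circ> \<sigma>) * ?F x)"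
    proof (rule eventually_mono[OF AE_lborel_power_inj_on[OF finite_lessThan]])
      fix x :: "nat \<Rightarrow> real" assume "inj_on x {..<n}"
      from sum_chamber_indicators[OF this] show "?F x = (\<Sum>\<sigma>\<in>?S. ?ind (x \<circ> \<sigma>) * ?F x)"
        by (simp only: sum_distrib_right[symmetric] mult_1_left)
    qed
    show "(\<lambda>x. \<Sum>\<sigma>\<in>?S. ?ind (x \<circ> \<sigma>) * ?F x) \<in> borel_measurable ?M"
      using borel_measurable_integrable[OF int] by (intro borel_measurable_sum) simp
  qed (fact Fm)
  also have "\<dots> = (\<Sum>\<sigma>\<in>?S. LINT x|?M. ?ind (x \<circ> \<sigma>) * ?F x)"
    using int by (intro Bochner_Integration.integral_sum) simp
  also have "\<dots> = (\<Sum>\<sigma>\<in>?S. pair_prod (n div 2) order_sign (inv_fun \<sigma>) * chamber_integral g n (i \<circ> \<sigma>))"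
    by (intro sum.cong refl summand) simp
  also have "\<dots> = (\<Sum>\<tau>\<in>?S. pair_prod (n div 2) order_sign \<tau> * chamber_integral g n (i \<circ> inv_fun \<tau>))"
    by (rule sum.reindex_bij_witness[of _ inv_fun inv_fun]) (auto simp: permutes_inv permutes_inv_inv)
  finally show ?thesis .
qed

section \<open>Products of double integrals as one integral\<close>

lemma distr_lborel_power_insert_two:
  assumes "finite I" "a \<notin> I" "b \<notin> I" "a \<noteq> b"
  shows "distr (lborel_power I \<Otimes>\<^sub>M (lborel \<Otimes>\<^sub>M lborel)) (lborel_power (insert b (insert a I)))
      (\<lambda>z. (fst z)(a := fst (snd z), b := snd (snd z))) = lborel_power (insert b (insert a I))"
    (is "distr ?N ?M ?t = ?M")
proof (rule lborel_product.PiM_eqI)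
  have "(\<lambda>z. (fst z)(a := fst (snd z))) \<in> measurable ?N (lborel_power (insert a I))"
    by (rule measurable_fun_upd[of _ I]) auto
  then have meas: "?t \<in> measurable ?N ?M"
    by (rule measurable_fun_upd[of _ "insert a I", rotated]) auto
  fix A :: "nat \<Rightarrow> real set" assume A: "\<And>i. i \<in> insert b (insert a I) \<Longrightarrow> A i \<in> sets lborel"
  have sf: "sigma_finite_measure (lborel \<Otimes>\<^sub>M lborel :: (real \<times> real) measure)"
    unfolding lborel_prod by (rule lborel.sigma_finite_measure_axioms)
  have "emeasure (distr ?N ?M ?t) (Pi\<^sub>E (insert b (insert a I)) A) =
      emeasure ?N (?t -` Pi\<^sub>E (insert b (insert a I)) A \<inter> space ?N)"
    using A assms by (intro emeasure_distr[OF meas] sets_PiM_I_finite) auto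
  also have "?t -` Pi\<^sub>E (insert b (insert a I)) A \<inter> space ?N = Pi\<^sub>E I A \<times> (A a \<times> A b)"
    using assms by (fastforce simp: space_pair_measure space_PiM PiE_iff extensional_def split: if_splits)
  also have "emeasure ?N (Pi\<^sub>E I A \<times> (A a \<times> A b)) =
      emeasure (lborel_power I) (Pi\<^sub>E I A) * emeasure (lborel \<Otimes>\<^sub>M lborel) (A a \<times> A b)"
    using A assms by (intro sigma_finite_measure.emeasure_pair_measure_Times[OF sf] sets_PiM_I_finite pair_measureI) auto
  also have "emeasure (lborel_power I) (Pi\<^sub>E I A) = (\<Prod>i\<in>I. emeasure lborel (A i))"
    using A assms by (intro lborel_product.emeasure_PiM) auto
  also have "emeasure (lborel \<Otimes>\<^sub>M lborel) (A a \<times> A b) = emeasure lborel (A a) * emeasure lborel (A b)"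
    using A by (intro lborel.emeasure_pair_measure_Times) auto
  finally show "emeasure (distr ?N ?M ?t) (Pi\<^sub>E (insert b (insert a I)) A) =
      (\<Prod>i\<in>insert b (insert a I). emeasure lborel (A i))"
    using assms by (simp only: prod.insert finite_insert insert_iff simp_thms mult_ac not_sym)
qed (use assms in simp_all)

lemma integral_lborel_power_insert_two_mult:
  fixes F :: "(nat \<Rightarrow> real) \<Rightarrow> complex" and k :: "real \<times> real \<Rightarrow> complex"
  assumes "finite I" "a \<notin> I" "b \<notin> I" "a \<noteq> b"
    and int: "integrable (lborel_power I) F" "integrable (lborel \<Otimes>\<^sub>M lborel) k"
    and F: "\<And>x u v. F (x(a := u, b := v)) = F x" "F \<in> borel_measurable (lborel_power (insert b (insert a I)))"
  shows "(LINT x|lborel_power (insert b (insert a I)). F x * k (x a, x b)) =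
    integral\<^sup>L (lborel_power I) F * integral\<^sup>L (lborel \<Otimes>\<^sub>M lborel) k"
proof -
  let ?N = "lborel_power I \<Otimes>\<^sub>M (lborel \<Otimes>\<^sub>M lborel)" and ?M = "lborel_power (insert b (insert a I))"
  let ?t = "\<lambda>z. (fst z)(a := fst (snd z), b := snd (snd z))"
  have "(\<lambda>z. (fst z)(a := fst (snd z))) \<in> measurable ?N (lborel_power (insert a I))"
    by (rule measurable_fun_upd[of _ I]) auto
  then have meas: "?t \<in> measurable ?N ?M"
    by (rule measurable_fun_upd[of _ "insert a I", rotated]) auto
  have "(\<lambda>x. (x a, x b)) \<in> measurable ?M (lborel \<Otimes>\<^sub>M lborel)"
    by (intro measurable_Pair measurable_component_singleton) auto
  then have f: "(\<lambda>x. F x * k (x a, x b)) \<in> borel_measurable ?M"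
    by (intro borel_measurable_times F(2) measurable_compose[OF _ borel_measurable_integrable[OF int(2)]])
  have sf: "sigma_finite_measure (lborel \<Otimes>\<^sub>M lborel :: (real \<times> real) measure)"
    unfolding lborel_prod by (rule lborel.sigma_finite_measure_axioms)
  have "(LINT x|?M. F x * k (x a, x b)) = (LINT x|distr ?N ?M ?t. F x * k (x a, x b))"
    by (simp only: distr_lborel_power_insert_two[OF assms(1-4)])
  also have "\<dots> = (LINT z|?N. F (?t z) * k (?t z a, ?t z b))" by (rule integral_distr[OF meas f])
  also have "\<dots> = (LINT z|?N. F (fst z) * k (snd z))"
    unfolding F(1) using assms(4) by simp
  also have "\<dots> = integral\<^sup>L (lborel_power I) F * integral\<^sup>L (lborel \<Otimes>\<^sub>M lborel) k"
    by (rule integral_pair_mult(2)[OF lborel_product.sigma_finite[OF assms(1)] sf int])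
  finally show ?thesis .
qed

lemma integrable_pair_kernel:
  fixes g :: "nat \<Rightarrow> real \<Rightarrow> complex"
  assumes "integrable lborel (g i)" "integrable lborel (g j)"
  shows "integrable (lborel \<Otimes>\<^sub>M lborel) (\<lambda>z. order_sign (fst z) (snd z) * g i (fst z) * g j (snd z))"
proof (rule Bochner_Integration.integrable_bound)
  note S = lborel.sigma_finite_measure_axioms
  show "integrable (lborel \<Otimes>\<^sub>M lborel) (\<lambda>z. g i (fst z) * g j (snd z))"
    by (rule integral_pair_mult(1)[OF S S assms])
  have gm: "g i \<in> borel_measurable lborel" "g j \<in> borel_measurable lborel"
    using assms[THEN borel_measurable_integrable] by simp_all
  show "(\<lambda>z. order_sign (fst z) (snd z) * g i (fst z) * g j (snd z)) \<in> borel_measurable (lborel \<Otimes>\<^sub>M lborel)"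
    by (intro borel_measurable_times measurable_compose[OF measurable_fst gm(1)]
        measurable_compose[OF measurable_snd gm(2)])
       (rule measurable_order_sign, simp_all)
  show "AE z in lborel \<Otimes>\<^sub>M lborel. norm (order_sign (fst z) (snd z) * g i (fst z) * g j (snd z)) \<le> norm (g i (fst z) * g j (snd z))"
    by (intro AE_I2) (simp add: norm_mult mult_left_le_one_le norm_order_sign_le mult.assoc)
qed

text \<open>
  The coupled coordinates separate into consecutive pairs, so Fubini's theorem splits the integral.
\<close>

lemma integral_paired_integrand_product:
  assumes g: "\<And>j. integrable lborel (g j)"
  shows "(LINT x|lborel_power {..<2*m}. paired_integrand g (2*m) i x) = pair_prod m (pair_integral g) i"
    and "(LINT x|lborel_power {..<2*m+1}. paired_integrand g (2*m+1) i x) =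
      pair_prod m (pair_integral g) i * integral\<^sup>L lborel (g (i (2*m)))"
proof -
  have gm: "g j \<in> borel_measurable borel" for j using borel_measurable_integrable[OF g[of j]] by simp
  show even: "(LINT x|lborel_power {..<2*m}. paired_integrand g (2*m) i x) = pair_prod m (pair_integral g) i" for m
  proof (induction m)
    case 0
    show ?case by (simp add: paired_integrand_def pair_prod_def PiM_empty)
  next
    case (Suc m)
    let ?F = "paired_integrand g (2*m) i"
    let ?k = "\<lambda>z. order_sign (fst z) (snd z) * g (i (2*m)) (fst z) * g (i (2*m+1)) (snd z)"
    have split: "paired_integrand g (2 * Suc m) i x = ?F x * ?k (x (2*m), x (2*m+1))" for x
      unfolding paired_integrand_def by (simp add: mult_ac)
    have "{..<2 * Suc m} = insert (2*m+1) (insert (2*m) {..<2*m})" by auto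
    moreover have "(LINT x|lborel_power (insert (2*m+1) (insert (2*m) {..<2*m})). ?F x * ?k (x (2*m), x (2*m+1))) =
        integral\<^sup>L (lborel_power {..<2*m}) ?F * integral\<^sup>L (lborel \<Otimes>\<^sub>M lborel) ?k"
    proof (rule integral_lborel_power_insert_two_mult)
      show "integrable (lborel_power {..<2*m}) ?F" by (rule integrable_paired_integrand[OF g])
      show "integrable (lborel \<Otimes>\<^sub>M lborel) ?k" by (rule integrable_pair_kernel[OF g g])
      show "?F (x(2*m := u, 2*m+1 := v)) = ?F x" for x u v by (rule paired_integrand_cong) simp
      show "?F \<in> borel_measurable (lborel_power (insert (2*m+1) (insert (2*m) {..<2*m})))"
        by (rule measurable_paired_integrand[OF gm]) auto
    qed simp_all
    ultimately show ?case unfolding split using Suc.IH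
      by (simp only: pair_prod_def prod.lessThan_Suc pair_integral_def)
  qed
  let ?F = "paired_integrand g (2*m) i"
  have split: "paired_integrand g (2*m+1) i x = ?F x * g (i (2*m)) (x (2*m))" for x
    unfolding paired_integrand_def by (simp add: mult_ac)
  have "{..<2*m+1} = insert (2*m) {..<2*m}" by auto
  moreover have "(LINT x|lborel_power (insert (2*m) {..<2*m}). ?F x * g (i (2*m)) (x (2*m))) =
      integral\<^sup>L (lborel_power {..<2*m}) ?F * integral\<^sup>L lborel (g (i (2*m)))"
  proof (rule integral_lborel_power_insert_mult)
    show "integrable (lborel_power {..<2*m}) ?F" by (rule integrable_paired_integrand[OF g])
    show "?F (x(2*m := u)) = ?F x" for x u by (rule paired_integrand_cong) simp
    show "?F \<in> borel_measurable (lborel_power (insert (2*m) {..<2*m}))"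
      by (rule measurable_paired_integrand[OF gm]) auto
  qed (simp_all add: g)
  ultimately show "(LINT x|lborel_power {..<2*m+1}. paired_integrand g (2*m+1) i x) =
      pair_prod m (pair_integral g) i * integral\<^sup>L lborel (g (i (2*m)))"
    unfolding split even by (simp only:)
qed

section \<open>Vandermonde determinants of monic polynomials\<close>

text \<open>
  As a function of the last point the determinant is a polynomial of degree at most \<open>n\<close> that vanishes
  at the other points, with the smaller determinant as its coefficient of degree \<open>n\<close>. This determines it if the points
  are distinct; otherwise both sides vanish.
\<close>

theorem det_monic_polys:
  fixes p :: "nat \<Rightarrow> complex poly"
  assumes "\<And>j. j < n \<Longrightarrow> degree (p j) = j \<and> lead_coeff (p j) = 1"
  shows "det (mat n n (\<lambda>(i, j). poly (p j) (x i))) = (\<Prod>j<n. \<Prod>i<j. x j - x i)"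
  using assms
proof (induction n)
  case 0
  show ?case by (simp add: det_dim_zero)
next
  case (Suc n)
  define A where "A t = mat (Suc n) (Suc n) (\<lambda>(i, j). poly (p j) (if i = n then t else x i))" for t
  have A_carrier: "A t \<in> carrier_mat (Suc n) (Suc n)" for t by (simp add: A_def)
  define c where "c j = cofactor (A 0) n j" for j
  have minor: "mat_delete (A t) n j = mat_delete (A 0) n j" for t j
    by (rule eq_matI) (auto simp: A_def mat_delete_def)
  have c: "cofactor (A t) n j = c j" for t j unfolding c_def cofactor_def minor[of t] ..
  have "det (mat n n (\<lambda>(i, j). poly (p j) (x i))) = (\<Prod>j<n. \<Prod>i<j. x j - x i)"
    by (rule Suc.IH) (rule Suc.prems, erule less_SucI)
  moreover have "mat_delete (A 0) n n = mat n n (\<lambda>(i, j). poly (p j) (x i))"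
    by (rule eq_matI) (auto simp: A_def mat_delete_def)
  ultimately have c_n: "c n = (\<Prod>j<n. \<Prod>i<j. x j - x i)"
    unfolding c_def cofactor_def by simp
  \<comment> \<open>The cofactors along the last row do not involve the last point \<open>t\<close>.\<close>
  define q where "q = (\<Sum>j<Suc n. smult (c j) (p j))"
  have det_A: "det (A t) = poly q t" for t
    using laplace_expansion_row[OF A_carrier, of n t]
    unfolding q_def poly_sum c by (simp add: A_def mult.commute)
  have same: "mat (Suc n) (Suc n) (\<lambda>(i, j). poly (p j) (x i)) = A (x n)"
    by (rule eq_matI) (auto simp: A_def)
  have target: "(\<Prod>j<Suc n. \<Prod>i<j. x j - x i) = c n * (\<Prod>i<n. x n - x i)" unfolding c_n by simp
  have root: "poly q (x i) = 0" if "i < n" for i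
  proof -
    have "det (A (x i)) = 0"
      by (rule Determinant.det_identical_rows[OF A_carrier, of i n]) (use that in \<open>auto simp: A_def Matrix.row_def intro!: eq_vecI\<close>)
    then show ?thesis by (simp add: det_A)
  qed
  show ?case
  proof (cases "inj_on x {..<n}")
    case True
    define b where "b = (\<Prod>i<n. [:- x i, 1:])"
    have b: "degree b = n" "poly b t = (\<Prod>i<n. t - x i)" for t
      unfolding b_def by (simp_all add: degree_prod_eq_sum_degree poly_prod)
    have lead_b: "lead_coeff b = 1" unfolding b_def lead_coeff_prod by simp
    define r where "r = q - smult (c n) b"
    have coeff_q: "coeff q n = c n" "coeff q i = 0" if "n < i" for i
    proof -
      have "coeff (p j) i = 0" if "j < Suc n" for j
        using Suc.prems[OF that] that \<open>n < i\<close> by (intro coeff_eq_0) simp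
      then show "coeff q i = 0" unfolding q_def coeff_sum by simp
      have "coeff (p j) n = (if j = n then 1 else 0)" if "j < Suc n" for j
        using Suc.prems[OF that] that by (auto intro!: coeff_eq_0)
      then show "coeff q n = c n" unfolding q_def coeff_sum by simp
    qed
    have "coeff r i = 0" if "n \<le> i" for i
      using that coeff_q[of "Suc n"] coeff_q(2)[of i] b(1) lead_b coeff_eq_0[of b i]
      unfolding r_def by (cases "i = n") auto
    then have deg: "r = 0 \<or> degree r < n"
      by (metis leading_coeff_0_iff not_le)
    have "r = 0"
    proof (rule ccontr)
      assume "r \<noteq> 0"
      have "x ` {..<n} \<subseteq> {t. poly r t = 0}"
        using root b(2) unfolding r_def by (auto simp: prod_zero_iff)
      then have "card (x ` {..<n}) \<le> card {t. poly r t = 0}"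
        by (rule card_mono[OF poly_roots_finite[OF \<open>r \<noteq> 0\<close>]])
      also have "\<dots> \<le> degree r" by (rule card_poly_roots_bound[OF \<open>r \<noteq> 0\<close>])
      finally show False using deg \<open>r \<noteq> 0\<close> card_image[OF True] by simp
    qed
    then have "poly q (x n) = c n * (\<Prod>i<n. x n - x i)" using b(2) unfolding r_def by simp
    then show ?thesis unfolding same det_A target .
  next
    case False
    then obtain i j where ij: "i < j" "j < n" "x i = x j"
      unfolding inj_on_def by (metis lessThan_iff linorder_neqE_nat)
    have "(\<Prod>i<j. x j - x i) = 0" by (rule prod_zero) (use ij in \<open>auto intro!: bexI[of _ i]\<close>)
    then have "c n = 0" unfolding c_n using ij by (auto simp: prod_zero_iff)
    moreover have "det (A (x n)) = 0"
      by (rule Determinant.det_identical_rows[OF A_carrier, of i j]) (use ij in \<open>auto simp: A_def Matrix.row_def intro!: eq_vecI\<close>)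
    ultimately show ?thesis unfolding same target by simp
  qed
qed

section \<open>Bordered Pfaffians of double integrals\<close>

lemma pair_prod_cong:
  assumes "\<sigma> permutes {..<n}" "2*m \<le> n" "\<And>i j. i < n \<Longrightarrow> j < n \<Longrightarrow> a i j = b i j"
  shows "pair_prod m a \<sigma> = pair_prod m b \<sigma>"
  unfolding pair_prod_def
proof (rule prod.cong[OF refl])
  fix k assume "k \<in> {..<m}"
  then have "2*k \<in> {..<n}" "2*k+1 \<in> {..<n}" using assms(2) by auto
  then have "\<sigma> (2*k) < n" "\<sigma> (2*k+1) < n" using permutes_in_image[OF assms(1)] by blast+
  then show "a (\<sigma> (2*k)) (\<sigma> (2*k+1)) = b (\<sigma> (2*k)) (\<sigma> (2*k+1))" by (rule assms(3))
qed

text \<open>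
  Antisymmetrization over the indices makes all chambers contribute the same signed sum: the
  renaming \<open>\<tau>\<close> is absorbed into \<open>\<sigma>\<close> at the cost of \<open>sign \<tau>\<close>. The free value \<open>\<sigma> n\<close> carries
  the border and is not affected, since \<open>\<tau>\<close> fixes \<open>n\<close>.
\<close>

theorem signed_sum_integral_paired_integrand:
  assumes g: "\<And>j. integrable lborel (g j)"
  shows "(\<Sum>\<sigma> | \<sigma> permutes {..<Suc n}.
      of_int (sign \<sigma>) * (LINT x|lborel_power {..<n}. paired_integrand g n \<sigma> x) * q (\<sigma> n)) =
    of_nat (card (pair_group (n div 2))) *
      (\<Sum>\<sigma> | \<sigma> permutes {..<Suc n}. of_int (sign \<sigma>) * chamber_integral g n \<sigma> * q (\<sigma> n))"
proof -
  let ?S = "{\<sigma> :: nat \<Rightarrow> nat. \<sigma> permutes {..<Suc n}}" and ?T = "{\<tau> :: nat \<Rightarrow> nat. \<tau> permutes {..<n}}"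
  let ?J = "chamber_integral g n" and ?s = "pair_prod (n div 2) (order_sign :: nat \<Rightarrow> nat \<Rightarrow> complex)"
  have inner: "(\<Sum>\<sigma>\<in>?S. of_int (sign \<sigma>) * ?J (\<sigma> \<circ> inv_fun \<tau>) * q (\<sigma> n)) =
      of_int (sign \<tau>) * (\<Sum>\<sigma>\<in>?S. of_int (sign \<sigma>) * ?J \<sigma> * q (\<sigma> n))" if "\<tau> permutes {..<n}" for \<tau>
  proof -
    note inv = permutes_inv_o[OF that]
    have \<tau>: "\<tau> permutes {..<Suc n}" by (rule permutes_subset[OF that]) auto
    have fixed: "\<tau> n = n" using permutes_not_in[OF that] by simp
    have "(\<Sum>\<sigma>\<in>?S. of_int (sign \<sigma>) * ?J (\<sigma> \<circ> inv_fun \<tau>) * q (\<sigma> n)) =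
        (\<Sum>\<rho>\<in>?S. of_int (sign (\<rho> \<circ> \<tau>)) * ?J \<rho> * q (\<rho> n))"
    proof (rule sum.reindex_bij_witness[of _ "\<lambda>\<rho>. \<rho> \<circ> \<tau>" "\<lambda>\<sigma>. \<sigma> \<circ> inv_fun \<tau>"])
      fix \<sigma> :: "nat \<Rightarrow> nat"
      show 1: "\<sigma> \<circ> inv_fun \<tau> \<circ> \<tau> = \<sigma>" by (simp only: o_assoc[symmetric] inv comp_id)
      show "\<sigma> \<circ> \<tau> \<circ> inv_fun \<tau> = \<sigma>" by (simp only: o_assoc[symmetric] inv comp_id)
      show "\<sigma> \<circ> inv_fun \<tau> \<in> ?S" if "\<sigma> \<in> ?S"
        using that permutes_compose[OF permutes_inv[OF \<tau>], of \<sigma>] by (simp only: mem_Collect_eq)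
      show "\<sigma> \<circ> \<tau> \<in> ?S" if "\<sigma> \<in> ?S"
        using that permutes_compose[OF \<tau>, of \<sigma>] by (simp only: mem_Collect_eq)
      have "inv_fun \<tau> n = n" using permutes_not_in[OF permutes_inv[OF \<open>\<tau> permutes {..<n}\<close>]] by simp
      then show "of_int (sign (\<sigma> \<circ> inv_fun \<tau> \<circ> \<tau>)) * ?J (\<sigma> \<circ> inv_fun \<tau>) * q ((\<sigma> \<circ> inv_fun \<tau>) n) =
          of_int (sign \<sigma>) * ?J (\<sigma> \<circ> inv_fun \<tau>) * q (\<sigma> n)"
        unfolding 1 by (simp only: o_apply)
    qed
    also have "\<dots> = (\<Sum>\<rho>\<in>?S. of_int (sign \<tau>) * (of_int (sign \<rho>) * ?J \<rho> * q (\<rho> n)))"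
    proof (rule sum.cong[OF refl])
      fix \<rho> :: "nat \<Rightarrow> nat" assume "\<rho> \<in> ?S"
      then have "permutation \<rho>" "permutation \<tau>"
        using \<tau> permutation_permutes by (metis finite_lessThan mem_Collect_eq)+
      then have "sign (\<rho> \<circ> \<tau>) = sign \<rho> * sign \<tau>" by (rule sign_compose)
      then show "of_int (sign (\<rho> \<circ> \<tau>)) * ?J \<rho> * q (\<rho> n) = of_int (sign \<tau>) * (of_int (sign \<rho>) * ?J \<rho> * q (\<rho> n))"
        by (simp only: of_int_mult mult_ac)
    qed
    finally show ?thesis by (simp only: sum_distrib_left)
  qed
  have "(\<Sum>\<sigma>\<in>?S. of_int (sign \<sigma>) * (LINT x|lborel_power {..<n}. paired_integrand g n \<sigma> x) * q (\<sigma> n)) =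
      (\<Sum>\<sigma>\<in>?S. \<Sum>\<tau>\<in>?T. ?s \<tau> * (of_int (sign \<sigma>) * ?J (\<sigma> \<circ> inv_fun \<tau>) * q (\<sigma> n)))"
    by (rule sum.cong[OF refl])
       (simp only: integral_paired_integrand_chambers[OF g] sum_distrib_left sum_distrib_right mult_ac)
  also have "\<dots> = (\<Sum>\<tau>\<in>?T. ?s \<tau> * (\<Sum>\<sigma>\<in>?S. of_int (sign \<sigma>) * ?J (\<sigma> \<circ> inv_fun \<tau>) * q (\<sigma> n)))"
    by (subst sum.swap) (simp only: sum_distrib_left)
  also have "\<dots> = (\<Sum>\<tau>\<in>?T. signed_pair_prod (n div 2) order_sign \<tau> *
      (\<Sum>\<sigma>\<in>?S. of_int (sign \<sigma>) * ?J \<sigma> * q (\<sigma> n)))"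
  proof (rule sum.cong[OF refl])
    fix \<tau> assume "\<tau> \<in> ?T"
    then show "?s \<tau> * (\<Sum>\<sigma>\<in>?S. of_int (sign \<sigma>) * ?J (\<sigma> \<circ> inv_fun \<tau>) * q (\<sigma> n)) =
        signed_pair_prod (n div 2) order_sign \<tau> * (\<Sum>\<sigma>\<in>?S. of_int (sign \<sigma>) * ?J \<sigma> * q (\<sigma> n))"
      using inner[of \<tau>] unfolding signed_pair_prod_def by (simp only: mem_Collect_eq mult_ac)
  qed
  also have "\<dots> = of_nat (card (pair_group (n div 2))) * (\<Sum>\<sigma>\<in>?S. of_int (sign \<sigma>) * ?J \<sigma> * q (\<sigma> n))"
    by (simp only: sum_distrib_right[symmetric] sum_signed_pair_prod_order_sign[OF refl])
  finally show ?thesis .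
qed

lemma card_pair_group_pos: "card (pair_group m) > 0"
  using finite_pair_group pair_group.id by (metis card_gt_0_iff empty_iff)

text \<open>
  De Bruijn's formula with one border column. Putting the border index last leaves products of \<open>m\<close>
  double integrals, which are integrals over \<open>\<real>\<close> to the power \<open>2m\<close>; the orders of the pair groups cancel.
\<close>

theorem pf_bordered_even:
  assumes g: "\<And>j. integrable lborel (g j)" and dim: "dim_row A = 2*m+2"
    and skew: "skew_on (2*m+2) (\<lambda>i j. A $$ (i, j))"
    and V: "\<And>i j. i < 2*m+1 \<Longrightarrow> j < 2*m+1 \<Longrightarrow> A $$ (i, j) = pair_integral g i j"
    and q: "\<And>i. i < 2*m+1 \<Longrightarrow> A $$ (i, 2*m+1) = q i"
  shows "pf A = (\<Sum>\<sigma> | \<sigma> permutes {..<2*m+1}.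
    of_int (sign \<sigma>) * chamber_integral g (2*m) \<sigma> * q (\<sigma> (2*m)))" (is "_ = ?I")
proof -
  let ?a = "\<lambda>i j. A $$ (i, j)"
  have "of_nat (card (pair_group (m+1))) * pf A =
      (\<Sum>\<sigma> | \<sigma> permutes {..<2*m+2}. signed_pair_prod (m+1) ?a \<sigma>)"
    using pfaffian_as_full_sum[of A "m+1"] dim skew by simp
  also have "\<dots> = of_nat (2*m+2) * (\<Sum>\<sigma> | \<sigma> permutes {..<2*m+1}. signed_pair_prod m ?a \<sigma> * ?a (\<sigma> (2*m)) (2*m+1))"
    by (rule sum_signed_pair_prod_fix_last[OF skew])
  also have "(\<Sum>\<sigma> | \<sigma> permutes {..<2*m+1}. signed_pair_prod m ?a \<sigma> * ?a (\<sigma> (2*m)) (2*m+1)) =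
      (\<Sum>\<sigma> | \<sigma> permutes {..<Suc (2*m)}.
        of_int (sign \<sigma>) * (LINT x|lborel_power {..<2*m}. paired_integrand g (2*m) \<sigma> x) * q (\<sigma> (2*m)))"
  proof (rule sum.cong, simp, clarify)
    fix \<sigma> :: "nat \<Rightarrow> nat" assume "\<sigma> permutes {..<Suc (2*m)}"
    then have \<sigma>: "\<sigma> permutes {..<2*m+1}" by simp
    have "pair_prod m ?a \<sigma> = pair_prod m (pair_integral g) \<sigma>"
      by (rule pair_prod_cong[OF \<sigma> _ V]) simp_all
    moreover have "\<sigma> (2*m) < 2*m+1" using permutes_in_image[OF \<sigma>, of "2*m"] by simp
    ultimately show "signed_pair_prod m ?a \<sigma> * ?a (\<sigma> (2*m)) (2*m+1) =
        of_int (sign \<sigma>) * (LINT x|lborel_power {..<2*m}. paired_integrand g (2*m) \<sigma> x) * q (\<sigma> (2*m))"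
      unfolding signed_pair_prod_def by (simp only: q integral_paired_integrand_product(1)[OF g])
  qed
  also have "\<dots> = of_nat (card (pair_group m)) * ?I"
    using signed_sum_integral_paired_integrand[OF g, where n = "2*m" and q = q] by simp
  finally have "of_nat (card (pair_group (m+1))) * pf A = of_nat (card (pair_group (m+1))) * ?I"
    by (simp only: card_pair_group_Suc of_nat_mult mult.assoc)
  then show ?thesis using card_pair_group_pos[of "m+1"] by simp
qed

text \<open>
  De Bruijn's formula with two border columns, one of which consists of single integrals. The terms in
  which the two border indices are paired with each other carry the corner entry \<open>1\<close> and make up
  the subtracted Pfaffian. In the others the single integral completes the product of \<open>m\<close> double
  integrals to one over \<open>\<real>\<close> to the power \<open>2m+1\<close>.
\<close>

theorem pf_bordered_odd:
  assumes g: "\<And>j. integrable lborel (g j)" and dim: "dim_row A = 2*m+4" "dim_row B = 2*m+2"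
    and skew: "skew_on (2*m+4) (\<lambda>i j. A $$ (i, j))"
    and V: "\<And>i j. i < 2*m+2 \<Longrightarrow> j < 2*m+2 \<Longrightarrow> A $$ (i, j) = pair_integral g i j"
      "\<And>i j. i < 2*m+2 \<Longrightarrow> j < 2*m+2 \<Longrightarrow> B $$ (i, j) = pair_integral g i j"
    and W: "\<And>i. i < 2*m+2 \<Longrightarrow> A $$ (i, 2*m+2) = integral\<^sup>L lborel (g i)"
    and q: "\<And>i. i < 2*m+2 \<Longrightarrow> A $$ (i, 2*m+3) = q i" and corner: "A $$ (2*m+2, 2*m+3) = 1"
  shows "pf A - pf B = - (\<Sum>\<sigma> | \<sigma> permutes {..<2*m+2}.
    of_int (sign \<sigma>) * chamber_integral g (2*m+1) \<sigma> * q (\<sigma> (2*m+1)))" (is "_ = - ?I")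
proof -
  let ?a = "\<lambda>i j. A $$ (i, j)"
  let ?R = "\<Sum>\<sigma> | \<sigma> permutes {..<2*m+2}. signed_pair_prod m ?a \<sigma> * ?a (\<sigma> (2*m)) (2*m+2) * ?a (\<sigma> (2*m+1)) (2*m+3)"
  let ?h = "\<lambda>k. of_nat (card (pair_group k)) :: complex"
  have skewB: "skew_on (2*(m+1)) (\<lambda>i j. B $$ (i, j))"
    unfolding skew_on_def
  proof (intro allI impI)
    fix i j assume "i < 2*(m+1)" "j < 2*(m+1)"
    then have ij: "i < 2*m+2" "j < 2*m+2" "i < 2*m+4" "j < 2*m+4" by simp_all
    have "A $$ (j, i) = - A $$ (i, j)" using skew ij unfolding skew_on_def by blast
    then show "B $$ (j, i) = - B $$ (i, j)" by (simp only: V ij)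
  qed
  have "(\<Sum>\<sigma> | \<sigma> permutes {..<2*m+2}. signed_pair_prod (m+1) ?a \<sigma>) =
      (\<Sum>\<sigma> | \<sigma> permutes {..<2*m+2}. signed_pair_prod (m+1) (\<lambda>i j. B $$ (i, j)) \<sigma>)"
  proof (rule sum.cong[OF refl], clarify)
    fix \<sigma> :: "nat \<Rightarrow> nat" assume "\<sigma> permutes {..<2*m+2}"
    then have "pair_prod (m+1) ?a \<sigma> = pair_prod (m+1) (\<lambda>i j. B $$ (i, j)) \<sigma>"
      by (rule pair_prod_cong) (simp_all only: V, simp)
    then show "signed_pair_prod (m+1) ?a \<sigma> = signed_pair_prod (m+1) (\<lambda>i j. B $$ (i, j)) \<sigma>"
      unfolding signed_pair_prod_def by (simp only:)
  qed
  also have "\<dots> = ?h (m+1) * pf B"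
    using pfaffian_as_full_sum[of B "m+1"] dim skewB by simp
  finally have B: "(\<Sum>\<sigma> | \<sigma> permutes {..<2*m+2}. signed_pair_prod (m+1) ?a \<sigma>) = ?h (m+1) * pf B" .
  have "?R = (\<Sum>\<sigma> | \<sigma> permutes {..<Suc (2*m+1)}. of_int (sign \<sigma>) *
      (LINT x|lborel_power {..<2*m+1}. paired_integrand g (2*m+1) \<sigma> x) * q (\<sigma> (2*m+1)))"
  proof (rule sum.cong, simp, clarify)
    fix \<sigma> :: "nat \<Rightarrow> nat" assume "\<sigma> permutes {..<Suc (2*m+1)}"
    then have \<sigma>: "\<sigma> permutes {..<2*m+2}" by simp
    have "pair_prod m ?a \<sigma> = pair_prod m (pair_integral g) \<sigma>"
      by (rule pair_prod_cong[OF \<sigma> _ V(1)]) simp_all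
    moreover have "\<sigma> (2*m) < 2*m+2" "\<sigma> (2*m+1) < 2*m+2"
      using permutes_in_image[OF \<sigma>, of "2*m"] permutes_in_image[OF \<sigma>, of "2*m+1"] by simp_all
    ultimately show "signed_pair_prod m ?a \<sigma> * ?a (\<sigma> (2*m)) (2*m+2) * ?a (\<sigma> (2*m+1)) (2*m+3) =
        of_int (sign \<sigma>) * (LINT x|lborel_power {..<2*m+1}. paired_integrand g (2*m+1) \<sigma> x) * q (\<sigma> (2*m+1))"
      unfolding signed_pair_prod_def by (simp only: q W integral_paired_integrand_product(2)[OF g] mult.assoc)
  qed
  also have "\<dots> = ?h m * ?I"
    using signed_sum_integral_paired_integrand[OF g, where n = "2*m+1" and q = q] by simp
  finally have R: "?R = ?h m * ?I" .
  have shift: "m+1+1 = m+2" "2*(m+1)+2 = 2*m+4" "2*(m+2) = 2*m+4" by simp_all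
  have h: "?h (m+2) = of_nat (2*m+4) * ?h (m+1)" "?h (m+1) = of_nat (2*m+2) * ?h m"
    by (simp_all only: of_nat_mult[symmetric] of_nat_eq_iff card_pair_group_Suc[of "m+1", unfolded shift]
        card_pair_group_Suc[of m])
  have "?h (m+2) * pf A = (\<Sum>\<sigma> | \<sigma> permutes {..<2*m+4}. signed_pair_prod (m+2) ?a \<sigma>)"
    by (rule pfaffian_as_full_sum[of A "m+2", unfolded shift, OF dim(1) skew, symmetric])
  also have "\<dots> = of_nat (2*m+4) * (?h (m+1) * pf B * 1 - of_nat (2*m+2) * (?h m * ?I))"
    unfolding sum_signed_pair_prod_fix_last_two[OF skew] B R corner ..
  also have "\<dots> = ?h (m+2) * (pf B - ?I)" unfolding h by (simp only: algebra_simps mult_1_left)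
  finally have "pf A = pf B - ?I" using card_pair_group_pos[of "m+2"] by simp
  then show ?thesis by simp
qed

section \<open>From Lebesgue measurable weights to Borel weights\<close>

text \<open>
  Integrands built from a Lebesgue measurable weight agree almost everywhere with Borel ones; this and
  the next lemma let them be exchanged under the completed measure.
\<close>

lemma borel_measurable_completion_AE_eq:
  fixes f g :: "'a \<Rightarrow> 'b::topological_space"
  assumes g: "g \<in> borel_measurable M" and eq: "AE x in M. f x = g x"
  shows "f \<in> borel_measurable (completion M)"
proof (rule measurableI)
  fix S :: "'b set" assume S: "S \<in> sets borel"
  show "f -` S \<inter> space (completion M) \<in> sets (completion M)"
  proof (rule completion.in_sets_AE)
    show "g -` S \<inter> space M \<in> sets (completion M)" using measurable_sets[OF g S] by (rule sets_completionI_sets)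
    have "AE x in completion M. f x = g x" using eq by (rule AE_completion)
    then show "AE x in completion M. x \<in> g -` S \<inter> space M \<longleftrightarrow> x \<in> f -` S \<inter> space (completion M)"
      by (rule eventually_mono) simp
  qed simp
qed simp

lemma integral_completion_AE_eq:
  fixes f g :: "'a \<Rightarrow> 'b::{banach, second_countable_topology}"
  assumes g: "g \<in> borel_measurable M" and eq: "AE x in M. f x = g x"
  shows "integral\<^sup>L (completion M) f = integral\<^sup>L M g"
proof -
  have "integral\<^sup>L (completion M) f = integral\<^sup>L (completion M) g"
    by (rule integral_cong_AE[OF borel_measurable_completion_AE_eq[OF assms] measurable_completion[OF g] AE_completion[OF eq]])
  also have "\<dots> = integral\<^sup>L M g" by (rule integral_completion[OF g])
  finally show ?thesis .
qed

lemma AE_pair_notin_null: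
  fixes N :: "real set"
  assumes "N \<in> null_sets lborel"
  shows "AE z in (lborel \<Otimes>\<^sub>M lborel). fst z \<notin> N \<and> snd z \<notin> N"
proof (rule lborel_pair.AE_pair_measure)
  have N: "N \<in> sets borel" using assms by auto
  have "fst -` N \<inter> space (lborel \<Otimes>\<^sub>M lborel) \<in> sets (lborel \<Otimes>\<^sub>M lborel :: (real \<times> real) measure)"
    "snd -` N \<inter> space (lborel \<Otimes>\<^sub>M lborel) \<in> sets (lborel \<Otimes>\<^sub>M lborel :: (real \<times> real) measure)"
    using measurable_sets[OF measurable_fst[of lborel "lborel :: real measure"], of N]
      measurable_sets[OF measurable_snd[of "lborel :: real measure" lborel], of N] N by simp_all
  then have "space (lborel \<Otimes>\<^sub>M lborel) - (fst -` N \<inter> space (lborel \<Otimes>\<^sub>M lborel)) -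
      (snd -` N \<inter> space (lborel \<Otimes>\<^sub>M lborel)) \<in> sets (lborel \<Otimes>\<^sub>M lborel :: (real \<times> real) measure)"
    by (intro sets.Diff sets.top)
  moreover have "{z \<in> space (lborel \<Otimes>\<^sub>M lborel). fst z \<notin> N \<and> snd z \<notin> N} =
      space (lborel \<Otimes>\<^sub>M lborel) - (fst -` N \<inter> space (lborel \<Otimes>\<^sub>M lborel)) -
      (snd -` N \<inter> space (lborel \<Otimes>\<^sub>M lborel))" by auto
  ultimately show "{z \<in> space (lborel \<Otimes>\<^sub>M lborel). fst z \<notin> N \<and> snd z \<notin> N} \<in> sets (lborel \<Otimes>\<^sub>M lborel)"
    by (simp only:)
  have *: "AE x in lborel. x \<notin> N" using assms by (rule AE_not_in)
  show "AE x in lborel. AE y in lborel. fst (x, y) \<notin> N \<and> snd (x, y) \<notin> N"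
    using * by (rule eventually_mono) (use * in simp)
qed

text \<open>
  A null set of the line stays negligible in each coordinate, so a weight may be changed on it.
\<close>

lemma AE_lborel_power_notin_null:
  assumes "finite I" "N \<in> null_sets lborel"
  shows "AE x in lborel_power I. \<forall>k\<in>I. x k \<notin> N"
proof (rule AE_finite_allI[OF assms(1)])
  fix a assume "a \<in> I"
  define K where "K = I - {a}"
  have K: "finite K" "a \<notin> K" "I = insert a K" using assms(1) \<open>a \<in> I\<close> unfolding K_def by auto
  interpret pair_sigma_finite "lborel_power K" "lborel :: real measure"
    by (intro pair_sigma_finite.intro lborel_product.sigma_finite[OF K(1)] lborel.sigma_finite_measure_axioms)
  have meas: "(\<lambda>z. (fst z)(a := snd z)) \<in> measurable (lborel_power K \<Otimes>\<^sub>M lborel) (lborel_power I)"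
    unfolding K(3) by (rule measurable_fun_upd[of _ K]) auto
  have "(\<lambda>x. x a) -` N \<inter> space (lborel_power I) \<in> sets (lborel_power I)"
    by (rule measurable_sets[OF measurable_component_singleton[OF \<open>a \<in> I\<close>]]) (use assms(2) in auto)
  then have "space (lborel_power I) - ((\<lambda>x. x a) -` N \<inter> space (lborel_power I)) \<in> sets (lborel_power I)"
    by (intro sets.Diff sets.top)
  moreover have "space (lborel_power I) - ((\<lambda>x. x a) -` N \<inter> space (lborel_power I)) = {x \<in> space (lborel_power I). x a \<notin> N}"
    by auto
  ultimately have pred: "{x \<in> space (lborel_power I). x a \<notin> N} \<in> sets (lborel_power I)" by (simp only:)
  have "AE z in lborel_power K \<Otimes>\<^sub>M lborel. snd z \<notin> N"
  proof (rule AE_pair_measure)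
    have "space (lborel_power K \<Otimes>\<^sub>M lborel) - (snd -` N \<inter> space (lborel_power K \<Otimes>\<^sub>M lborel)) \<in> sets (lborel_power K \<Otimes>\<^sub>M lborel)"
      by (intro sets.Diff sets.top measurable_sets[OF measurable_snd]) (use assms(2) in auto)
    moreover have "{z \<in> space (lborel_power K \<Otimes>\<^sub>M lborel). snd z \<notin> N} =
        space (lborel_power K \<Otimes>\<^sub>M lborel) - (snd -` N \<inter> space (lborel_power K \<Otimes>\<^sub>M lborel))" by auto
    ultimately show "{z \<in> space (lborel_power K \<Otimes>\<^sub>M lborel). snd z \<notin> N} \<in> sets (lborel_power K \<Otimes>\<^sub>M lborel)"
      by (simp only:)
    show "AE x in lborel_power K. AE y in lborel. snd (x, y) \<notin> N"
      using AE_not_in[OF assms(2)] by simp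
  qed
  then have "AE z in lborel_power K \<Otimes>\<^sub>M lborel. ((fst z)(a := snd z)) a \<notin> N" by simp
  then have "AE x in distr (lborel_power K \<Otimes>\<^sub>M lborel) (lborel_power I) (\<lambda>z. (fst z)(a := snd z)). x a \<notin> N"
    using AE_distr_iff[OF meas pred] by simp
  then show "AE x in lborel_power I. x a \<notin> N" unfolding K(3) distr_lborel_power_insert[OF K(1,2)] .
qed

lemma lebesgue_measurable_complex_borel_version:
  fixes h :: "real \<Rightarrow> complex"
  assumes "h \<in> borel_measurable lebesgue"
  obtains h' N where "h' \<in> borel_measurable borel" "N \<in> null_sets lborel" "\<And>x. x \<notin> N \<Longrightarrow> h x = h' x"
proof -
  have "(\<lambda>x. Re (h x)) \<in> borel_measurable lebesgue" "(\<lambda>x. Im (h x)) \<in> borel_measurable lebesgue"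
    by (rule measurable_compose[OF assms borel_measurable_Re], rule measurable_compose[OF assms borel_measurable_Im])
  then obtain r s where r: "r \<in> borel_measurable lborel" "AE x in lborel. Re (h x) = r x"
    and s: "s \<in> borel_measurable lborel" "AE x in lborel. Im (h x) = s x"
    using completion_ex_borel_measurable_real by blast
  have "AE x in lborel. h x = Complex (r x) (s x)"
    using r(2) s(2) by eventually_elim (simp add: complex_eq_iff)
  then obtain N where N: "N \<in> null_sets lborel" "{x \<in> space lborel. h x \<noteq> Complex (r x) (s x)} \<subseteq> N"
    by (auto elim!: AE_E3 simp: eventually_ae_filter)
  have "(\<lambda>x. Complex (r x) (s x)) \<in> borel_measurable borel"
    using r(1) s(1) unfolding complex_eq_iff Complex_eq by measurable
  then show thesis using N that[of "\<lambda>x. Complex (r x) (s x)" N] by auto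
qed

text \<open>
  The weight \<open>1 + \<bar>x\<bar>^d\<close> dominates all powers of \<open>\<bar>x\<bar>\<close> up to the \<open>d\<close>-th.
\<close>

lemma integrable_poly_mult_weight:
  fixes P :: "complex poly" and h :: "real \<Rightarrow> complex"
  assumes h: "h \<in> borel_measurable borel" "integrable lborel (\<lambda>x. (1 + \<bar>x\<bar> ^ d) * cmod (h x))"
    and deg: "degree P \<le> d"
  shows "integrable lborel (\<lambda>x. poly P (of_real x) * h x)"
proof (rule Bochner_Integration.integrable_bound)
  define C where "C = (\<Sum>i\<le>degree P. cmod (coeff P i))"
  show "integrable lborel (\<lambda>x. C * ((1 + \<bar>x\<bar> ^ d) * cmod (h x)))"
    using h(2) by (rule integrable_mult_right)
  have "continuous_on UNIV (\<lambda>x :: real. poly P (of_real x))" by (intro continuous_intros)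
  then have "(\<lambda>x :: real. poly P (of_real x)) \<in> borel_measurable borel" by (rule borel_measurable_continuous_onI)
  then show "(\<lambda>x. poly P (of_real x) * h x) \<in> borel_measurable lborel" using h(1) by simp
  have power_le: "\<bar>x\<bar> ^ i \<le> 1 + \<bar>x\<bar> ^ d" if "i \<le> d" for x :: real and i
  proof (cases "\<bar>x\<bar> \<le> 1")
    case True
    then have "\<bar>x\<bar> ^ i \<le> 1" by (simp add: power_le_one)
    then show ?thesis by (simp add: add_increasing2)
  next
    case False
    then have "\<bar>x\<bar> ^ i \<le> \<bar>x\<bar> ^ d" using that by (intro power_increasing) simp_all
    then show ?thesis by simp
  qed
  have "cmod (poly P (of_real x)) \<le> C * (1 + \<bar>x\<bar> ^ d)" for x :: real
  proof -
    have "cmod (poly P (of_real x)) \<le> (\<Sum>i\<le>degree P. cmod (coeff P i * of_real x ^ i))"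
      unfolding poly_altdef by (rule norm_sum)
    also have "\<dots> \<le> (\<Sum>i\<le>degree P. cmod (coeff P i) * (1 + \<bar>x\<bar> ^ d))"
      using deg power_le by (intro sum_mono) (simp add: norm_mult norm_power mult_left_mono)
    finally show ?thesis unfolding C_def sum_distrib_right .
  qed
  then have "norm (poly P (of_real x) * h x) \<le> norm (C * ((1 + \<bar>x\<bar> ^ d) * cmod (h x)))" for x
  proof -
    have "C \<ge> 0" unfolding C_def by (intro sum_nonneg) simp
    then have "norm (C * ((1 + \<bar>x\<bar> ^ d) * cmod (h x))) = C * (1 + \<bar>x\<bar> ^ d) * cmod (h x)"
      by (simp add: abs_mult)
    moreover have "norm (poly P (of_real x) * h x) \<le> C * (1 + \<bar>x\<bar> ^ d) * cmod (h x)"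
      unfolding norm_mult using \<open>\<And>x :: real. cmod (poly P (of_real x)) \<le> C * (1 + \<bar>x\<bar> ^ d)\<close>
      by (intro mult_right_mono) simp_all
    ultimately show ?thesis by (simp only:)
  qed
  then show "AE x in lborel. norm (poly P (of_real x) * h x) \<le> norm (C * ((1 + \<bar>x\<bar> ^ d) * cmod (h x)))"
    by (intro AE_I2)
qed

section \<open>The entries of the matrices\<close>

text \<open>
  Splitting the plane along the diagonal and reflecting the lower half gives the two-by-two
  determinants over \<open>\<lambda>\<^sub>1 < \<lambda>\<^sub>2\<close>.
\<close>

lemma pair_integral_ordered:
  assumes g: "\<And>j. integrable lborel (g j)"
  shows "pair_integral g i j = (LINT z|(lborel \<Otimes>\<^sub>M lborel).
    indicator {z. fst z < snd z} z * (g i (fst z) * g j (snd z) - g j (fst z) * g i (snd z)))"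
proof -
  let ?M = "lborel \<Otimes>\<^sub>M lborel :: (real \<times> real) measure"
  note S = lborel.sigma_finite_measure_axioms
  have "{z :: real \<times> real. fst z < snd z} \<in> sets borel" "{z :: real \<times> real. snd z < fst z} \<in> sets borel"
    by (intro borel_open open_Collect_less continuous_intros)+
  then have sets: "{z :: real \<times> real. fst z < snd z} \<in> sets ?M" "{z :: real \<times> real. snd z < fst z} \<in> sets ?M"
    unfolding lborel_prod by simp_all
  have prod: "integrable ?M (\<lambda>z. g k (fst z) * g l (snd z))" for k l
    by (rule integral_pair_mult(1)[OF S S g g])
  have ind: "integrable ?M (\<lambda>z. indicator A z * (g k (fst z) * g l (snd z)))" if "A \<in> sets ?M" for A k l
  proof (rule Bochner_Integration.integrable_bound[OF prod[of k l]])
    show "(\<lambda>z. indicator A z * (g k (fst z) * g l (snd z))) \<in> borel_measurable ?M"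
      by (rule borel_measurable_times[OF borel_measurable_indicator[OF that] borel_measurable_integrable[OF prod]])
    show "AE z in ?M. norm (indicator A z * (g k (fst z) * g l (snd z))) \<le> norm (g k (fst z) * g l (snd z))"
      by (intro AE_I2) (simp add: norm_mult indicator_def)
  qed
  have "pair_integral g i j = (LINT z|?M. indicator {z. fst z < snd z} z * (g i (fst z) * g j (snd z)) -
      indicator {z. snd z < fst z} z * (g i (fst z) * g j (snd z)))"
    unfolding pair_integral_def by (rule Bochner_Integration.integral_cong) (auto simp: order_sign_def indicator_def)
  also have "\<dots> = (LINT z|?M. indicator {z. fst z < snd z} z * (g i (fst z) * g j (snd z))) -
      (LINT z|?M. indicator {z. snd z < fst z} z * (g i (fst z) * g j (snd z)))"
    by (rule Bochner_Integration.integral_diff[OF ind[OF sets(1)] ind[OF sets(2)]])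
  also have "(LINT z|?M. indicator {z. snd z < fst z} z * (g i (fst z) * g j (snd z))) =
      (LINT z|?M. indicator {z. fst z < snd z} z * (g j (fst z) * g i (snd z)))"
    using lborel_pair.integral_product_swap[OF borel_measurable_integrable[OF ind[OF sets(2), of i j]]]
    by (simp add: case_prod_unfold indicator_def mult.commute)
  also have "(LINT z|?M. indicator {z. fst z < snd z} z * (g i (fst z) * g j (snd z))) -
      (LINT z|?M. indicator {z. fst z < snd z} z * (g j (fst z) * g i (snd z))) =
      (LINT z|?M. indicator {z. fst z < snd z} z * (g i (fst z) * g j (snd z)) -
        indicator {z. fst z < snd z} z * (g j (fst z) * g i (snd z)))"
    by (rule Bochner_Integration.integral_diff[symmetric, OF ind[OF sets(1)] ind[OF sets(1)]])
  finally show ?thesis by (simp only: right_diff_distrib)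
qed

lemma pair_integral_antisym:
  assumes g: "\<And>j. integrable lborel (g j)"
  shows "pair_integral g j i = - pair_integral g i j"
  unfolding pair_integral_ordered[OF g, where i = i and j = j] pair_integral_ordered[OF g, where i = j and j = i] Bochner_Integration.integral_minus[symmetric]
  by (rule Bochner_Integration.integral_cong) (simp_all add: algebra_simps)

section \<open>The Vandermonde integral over the increasing chamber\<close>

text \<open>
  The product is the Vandermonde product of the \<open>d+1\<close> points \<open>y\<^sub>0, \<dots>, y\<^sub>d\<^sub>-\<^sub>1, c\<close>, except that each of the \<open>d\<close>
  factors containing \<open>c\<close> has the opposite sign.
\<close>

lemma weighted_vandermonde_expansion:
  fixes p :: "nat \<Rightarrow> complex poly" and y :: "nat \<Rightarrow> complex"
  assumes "\<And>j. j \<le> d \<Longrightarrow> degree (p j) = j \<and> lead_coeff (p j) = 1"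
  shows "(\<Prod>j<d. \<Prod>i<j. y j - y i) * (\<Prod>i<d. y i - c) * (\<Prod>i<d. w i) =
    (- 1) ^ d * (\<Sum>\<sigma> | \<sigma> permutes {..<Suc d}.
      of_int (sign \<sigma>) * (\<Prod>k<d. poly (p (\<sigma> k)) (y k) * w k) * poly (p (\<sigma> d)) c)"
proof -
  define x where "x i = (if i < d then y i else c)" for i
  let ?A = "mat (Suc d) (Suc d) (\<lambda>(i, j). poly (p j) (x i))"
  have "(\<Prod>j<d. \<Prod>i<j. y j - y i) * (\<Prod>i<d. y i - c) = (- 1) ^ d * (\<Prod>j<Suc d. \<Prod>i<j. x j - x i)"
  proof -
    have "(\<Prod>j<d. \<Prod>i<j. x j - x i) = (\<Prod>j<d. \<Prod>i<j. y j - y i)"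
      by (intro prod.cong) (auto simp: x_def)
    moreover have "(\<Prod>i<d. x d - x i) = (\<Prod>i<d. (- 1) * (y i - c))"
      by (rule prod.cong) (simp_all add: x_def)
    moreover have "(\<Prod>i<d. (- 1) * (y i - c)) = (- 1) ^ d * (\<Prod>i<d. y i - c)"
      unfolding prod.distrib by simp
    moreover have "(- 1) ^ d * (- 1) ^ d = (1 :: complex)"
      by (simp add: power_mult_distrib[symmetric])
    ultimately show ?thesis by (simp add: mult_ac)
  qed
  also have "(\<Prod>j<Suc d. \<Prod>i<j. x j - x i) = det ?A"
    by (rule det_monic_polys[symmetric]) (rule assms, simp)
  also have "det ?A = (\<Sum>\<sigma> | \<sigma> permutes {..<Suc d}. of_int (sign \<sigma>) * (\<Prod>k<Suc d. poly (p (\<sigma> k)) (x k)))"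
  proof -
    have "det ?A = (\<Sum>\<sigma> | \<sigma> permutes {0..<Suc d}. of_int (sign \<sigma>) * (\<Prod>k=0..<Suc d. ?A $$ (k, \<sigma> k)))"
      by (rule det_def') simp
    also have "\<dots> = (\<Sum>\<sigma> | \<sigma> permutes {0..<Suc d}. of_int (sign \<sigma>) * (\<Prod>k=0..<Suc d. poly (p (\<sigma> k)) (x k)))"
    proof (rule sum.cong[OF refl])
      fix \<sigma> assume "\<sigma> \<in> {\<sigma>. \<sigma> permutes {0..<Suc d}}"
      then have "\<sigma> k < Suc d" if "k < Suc d" for k
        using permutes_in_image[of \<sigma> "{0..<Suc d}" k] that by simp
      then have "(\<Prod>k=0..<Suc d. ?A $$ (k, \<sigma> k)) = (\<Prod>k=0..<Suc d. poly (p (\<sigma> k)) (x k))"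
        by (intro prod.cong refl) simp
      then show "of_int (sign \<sigma>) * (\<Prod>k=0..<Suc d. ?A $$ (k, \<sigma> k)) =
          of_int (sign \<sigma>) * (\<Prod>k=0..<Suc d. poly (p (\<sigma> k)) (x k))" by (simp only:)
    qed
    finally show ?thesis by (simp only: atLeast0LessThan)
  qed
  also have "(- 1) ^ d * \<dots> * (\<Prod>i<d. w i) = (- 1) ^ d * (\<Sum>\<sigma> | \<sigma> permutes {..<Suc d}.
      of_int (sign \<sigma>) * (\<Prod>k<Suc d. poly (p (\<sigma> k)) (x k)) * (\<Prod>i<d. w i))"
    by (simp only: mult.assoc sum_distrib_right)
  also have "\<dots> = (- 1) ^ d * (\<Sum>\<sigma> | \<sigma> permutes {..<Suc d}.
      of_int (sign \<sigma>) * (\<Prod>k<d. poly (p (\<sigma> k)) (y k) * w k) * poly (p (\<sigma> d)) c)"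
  proof -
    have "(\<Prod>k<Suc d. poly (p (\<sigma> k)) (x k)) * (\<Prod>i<d. w i) =
        (\<Prod>k<d. poly (p (\<sigma> k)) (y k) * w k) * poly (p (\<sigma> d)) c" for \<sigma>
    proof -
      have "(\<Prod>k<d. poly (p (\<sigma> k)) (x k)) = (\<Prod>k<d. poly (p (\<sigma> k)) (y k))"
        by (rule prod.cong) (simp_all add: x_def)
      then show ?thesis by (simp add: prod.distrib x_def mult_ac)
    qed
    then show ?thesis by (simp only: mult.assoc)
  qed
  finally show ?thesis .
qed

lemma prod_ordered_pairs_shift:
  fixes f :: "nat \<Rightarrow> nat \<Rightarrow> 'a::comm_monoid_mult"
  shows "(\<Prod>(i, j)\<in>{(i, j). 1 \<le> i \<and> i < j \<and> j \<le> d}. f i j) = (\<Prod>j<d. \<Prod>i<j. f (Suc i) (Suc j))"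
proof -
  have "(\<Prod>j<d. \<Prod>i<j. f (Suc i) (Suc j)) = (\<Prod>(j, i)\<in>Sigma {..<d} (\<lambda>j. {..<j}). f (Suc i) (Suc j))"
    by (rule prod.Sigma) simp_all
  also have "\<dots> = (\<Prod>(i, j)\<in>{(i, j). 1 \<le> i \<and> i < j \<and> j \<le> d}. f i j)"
    by (rule prod.reindex_bij_witness[of _ "\<lambda>(i, j). (j - 1, i - 1)" "\<lambda>(j, i). (Suc i, Suc j)"]) auto
  finally show ?thesis by simp
qed

lemma integrable_chamber_integrand:
  fixes g :: "nat \<Rightarrow> real \<Rightarrow> complex"
  assumes g: "\<And>j. integrable lborel (g j)"
  shows "integrable (lborel_power {..<n}) (\<lambda>x. indicator {x. strict_mono_on {..<n} x} x * (\<Prod>k<n. g (i k) (x k)))"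
proof (rule Bochner_Integration.integrable_bound)
  show int: "integrable (lborel_power {..<n}) (\<lambda>x. \<Prod>k<n. g (i k) (x k))"
    using lborel_product.product_integrable_prod[of "{..<n}" "\<lambda>k. g (i k)"] g by simp
  show "(\<lambda>x. indicator {x. strict_mono_on {..<n} x} x * (\<Prod>k<n. g (i k) (x k))) \<in> borel_measurable (lborel_power {..<n})"
    by (rule borel_measurable_times[OF measurable_indicator_chamber borel_measurable_integrable[OF int]])
  show "AE x in lborel_power {..<n}. norm (indicator {x. strict_mono_on {..<n} x} x * (\<Prod>k<n. g (i k) (x k)))
      \<le> norm (\<Prod>k<n. g (i k) (x k))"
    by (intro AE_I2) (simp add: norm_mult indicator_def)
qed

lemma det_two_rows: "det (mat_of_rows_list 2 [[a, b], [c, d :: 'a::comm_ring_1]]) = a * d - b * c"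
proof -
  let ?A = "mat_of_rows_list 2 [[a, b], [c, d]]"
  have A: "?A \<in> carrier_mat 2 2" by (rule carrier_matI) (simp_all add: mat_of_rows_list_def)
  have "det ?A = (\<Sum>j<2. ?A $$ (0, j) * cofactor ?A 0 j)" by (rule laplace_expansion_row[OF A]) simp
  also have "\<dots> = a * cofactor ?A 0 0 + b * cofactor ?A 0 1"
    by (simp add: numeral_2_eq_2 mat_of_rows_list_def)
  also have "cofactor ?A 0 0 = d"
    unfolding cofactor_def using det_single[of "mat_delete ?A 0 0"]
    by (simp add: mat_delete_def mat_of_rows_list_def)
  also have "cofactor ?A 0 1 = - c"
    unfolding cofactor_def using det_single[of "mat_delete ?A 0 1"]
    by (simp add: mat_delete_def mat_of_rows_list_def)
  finally show ?thesis by simp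
qed

lemma Vmat_entry:
  fixes p :: "nat \<Rightarrow> complex poly"
  assumes h': "h' \<in> borel_measurable borel" "N \<in> null_sets lborel" "\<And>x. x \<notin> N \<Longrightarrow> h x = h' x"
    and g: "\<And>j. integrable lborel (g j)" "\<And>j x. j \<le> d \<Longrightarrow> g j x = poly (p j) (of_real x) * h' x"
    and ij: "i \<le> d" "j \<le> d"
  shows "Vmat d p h $$ (i, j) = pair_integral g i j"
proof -
  let ?M = "lborel \<Otimes>\<^sub>M lborel :: (real \<times> real) measure"
  let ?f = "\<lambda>z :: real \<times> real. indicator {z. fst z < snd z} z * (g i (fst z) * g j (snd z) - g j (fst z) * g i (snd z))"
  have gm: "g j \<in> borel_measurable lborel" for j by (rule borel_measurable_integrable[OF g(1)])
  have "{z :: real \<times> real. fst z < snd z} \<in> sets borel"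
    by (intro borel_open open_Collect_less continuous_intros)
  then have "{z :: real \<times> real. fst z < snd z} \<in> sets ?M" unfolding lborel_prod by simp
  then have f: "?f \<in> borel_measurable ?M"
    by (intro borel_measurable_times borel_measurable_diff borel_measurable_indicator
        measurable_compose[OF measurable_fst gm] measurable_compose[OF measurable_snd gm])
  have "Vmat d p h $$ (i, j) = (LINT l:{l. fst l < snd l}|lebesgue.
      (poly (p i) (of_real (fst l)) * poly (p j) (of_real (snd l)) -
       poly (p j) (of_real (fst l)) * poly (p i) (of_real (snd l))) * h (fst l) * h (snd l))"
    using ij unfolding Vmat_def det_two_rows by simp
  also have "\<dots> = integral\<^sup>L (completion ?M) (\<lambda>l. indicator {l. fst l < snd l} l *\<^sub>R
      ((poly (p i) (of_real (fst l)) * poly (p j) (of_real (snd l)) -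
       poly (p j) (of_real (fst l)) * poly (p i) (of_real (snd l))) * h (fst l) * h (snd l)))"
    unfolding set_lebesgue_integral_def lborel_prod ..
  also have "\<dots> = integral\<^sup>L ?M ?f"
  proof (rule integral_completion_AE_eq[OF f])
    show "AE l in ?M. indicator {l. fst l < snd l} l *\<^sub>R
      ((poly (p i) (of_real (fst l)) * poly (p j) (of_real (snd l)) -
       poly (p j) (of_real (fst l)) * poly (p i) (of_real (snd l))) * h (fst l) * h (snd l)) = ?f l"
      using AE_pair_notin_null[OF h'(2)]
    proof (rule eventually_mono)
      fix l :: "real \<times> real" assume "fst l \<notin> N \<and> snd l \<notin> N"
      then have "h (fst l) = h' (fst l)" "h (snd l) = h' (snd l)" using h'(3) by simp_all
      then show "indicator {l. fst l < snd l} l *\<^sub>R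
        ((poly (p i) (of_real (fst l)) * poly (p j) (of_real (snd l)) -
         poly (p j) (of_real (fst l)) * poly (p i) (of_real (snd l))) * h (fst l) * h (snd l)) = ?f l"
        using ij by (simp add: g(2) indicator_def algebra_simps)
    qed
  qed
  also have "\<dots> = pair_integral g i j" by (rule pair_integral_ordered[OF g(1), symmetric])
  finally show ?thesis .
qed

lemma Wvec_entry:
  fixes p :: "nat \<Rightarrow> complex poly"
  assumes h': "N \<in> null_sets lborel" "\<And>x. x \<notin> N \<Longrightarrow> h x = h' x"
    and g: "\<And>j. integrable lborel (g j)" "\<And>j x. j \<le> d \<Longrightarrow> g j x = poly (p j) (of_real x) * h' x"
    and i: "i \<le> d"
  shows "Wvec d p h $ i = integral\<^sup>L lborel (g i)"
proof -
  have "Wvec d p h $ i = (LINT x|lebesgue. poly (p i) (of_real x) * h x)" using i by (simp add: Wvec_def)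
  also have "\<dots> = integral\<^sup>L lborel (g i)"
  proof (rule integral_completion_AE_eq[OF borel_measurable_integrable[OF g(1)]])
    show "AE x in lborel. poly (p i) (of_real x) * h x = g i x"
      using AE_not_in[OF h'(1)] by (rule eventually_mono) (simp add: h'(2) g(2)[OF i])
  qed
  finally show ?thesis .
qed

text \<open>
  The expansion of the determinant is integrated term by term. The points are numbered from \<open>1\<close> on the
  left and from \<open>0\<close> in the chamber, hence the renaming of coordinates by \<open>Suc\<close>.
\<close>

theorem integral_vandermonde_chamber:
  fixes p :: "nat \<Rightarrow> complex poly" and c :: real
  assumes h': "h' \<in> borel_measurable borel" "N \<in> null_sets lborel" "\<And>x. x \<notin> N \<Longrightarrow> h x = h' x"
    and p: "\<And>j. j \<le> d \<Longrightarrow> degree (p j) = j \<and> lead_coeff (p j) = 1"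
    and g: "\<And>j. integrable lborel (g j)" "\<And>j x. j \<le> d \<Longrightarrow> g j x = poly (p j) (of_real x) * h' x"
  shows "(LINT l:{l. strict_mono_on {1..d} l}|lebesgue_pow d.
            (\<Prod>(i, j)\<in>{(i, j). 1 \<le> i \<and> i < j \<and> j \<le> d}. of_real (l j - l i))
            * (\<Prod>i\<in>{1..d}. of_real (l i - c)) * (\<Prod>i\<in>{1..d}. h (l i))) =
    (- 1) ^ d * (\<Sum>\<sigma> | \<sigma> permutes {..<Suc d}.
      of_int (sign \<sigma>) * chamber_integral g d \<sigma> * poly (p (\<sigma> d)) (of_real c))"
proof -
  let ?I = "{1..d}" and ?K = "{..<d}"
  let ?L = "\<lambda>h l. indicator {l. strict_mono_on ?I l} l *\<^sub>R
      ((\<Prod>(i, j)\<in>{(i, j). 1 \<le> i \<and> i < j \<and> j \<le> d}. of_real (l j - l i))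
        * (\<Prod>i\<in>?I. of_real (l i - c)) * (\<Prod>i\<in>?I. h (l i))) :: complex"
  let ?ind = "indicator {x. strict_mono_on ?K x} :: (nat \<Rightarrow> real) \<Rightarrow> complex"
  define \<Phi> where "\<Phi> x = (- 1) ^ d * (\<Sum>\<sigma> | \<sigma> permutes {..<Suc d}.
      of_int (sign \<sigma>) * (?ind x * (\<Prod>k<d. g (\<sigma> k) (x k))) * poly (p (\<sigma> d)) (of_real c))" for x
  have bij: "bij_betw Suc ?K ?I"
    by (simp add: bij_betw_def image_Suc_lessThan)
  note int = integrable_chamber_integrand[OF g(1), where n = d]
  have \<Phi>_meas: "\<Phi> \<in> borel_measurable (lborel_power ?K)"
    unfolding \<Phi>_def
    by (intro borel_measurable_times[OF borel_measurable_const] borel_measurable_sum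
        borel_measurable_times[OF _ borel_measurable_const] borel_measurable_integrable[OF int])
  have L_\<Phi>: "?L h' l = \<Phi> (\<lambda>k\<in>?K. l (Suc k))" for l
  proof -
    let ?x = "\<lambda>k\<in>?K. l (Suc k)"
    have mono: "strict_mono_on ?I l \<longleftrightarrow> strict_mono_on ?K ?x"
    proof
      assume l: "strict_mono_on ?I l"
      show "strict_mono_on ?K ?x"
      proof (rule strict_mono_onI)
        fix r s assume "r \<in> ?K" "s \<in> ?K" "r < s"
        then show "?x r < ?x s" using strict_mono_onD[OF l, of "Suc r" "Suc s"] by simp
      qed
    next
      assume x: "strict_mono_on ?K ?x"
      show "strict_mono_on ?I l"
      proof (rule strict_mono_onI)
        fix r s assume "r \<in> ?I" "s \<in> ?I" "r < s"
        then have "r - 1 \<in> ?K" "s - 1 \<in> ?K" "r - 1 < s - 1" "Suc (r - 1) = r" "Suc (s - 1) = s" by auto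
        then show "l r < l s" using strict_mono_onD[OF x, of "r - 1" "s - 1"] by simp
      qed
    qed
    have "(\<Prod>i\<in>?I. h' (l i)) = (\<Prod>k<d. h' (l (Suc k)))"
      by (rule prod.reindex_bij_betw[OF bij, symmetric])
    moreover have "(\<Prod>i\<in>?I. of_real (l i - c) :: complex) = (\<Prod>k<d. of_real (l (Suc k)) - of_real c)"
      unfolding of_real_diff by (rule prod.reindex_bij_betw[OF bij, symmetric])
    moreover have "(\<Prod>(i, j)\<in>{(i, j). 1 \<le> i \<and> i < j \<and> j \<le> d}. of_real (l j - l i) :: complex) =
        (\<Prod>j<d. \<Prod>i<j. of_real (l (Suc j)) - of_real (l (Suc i)))"
      using prod_ordered_pairs_shift[of "\<lambda>i j. of_real (l j - l i) :: complex" d] by simp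
    ultimately have "?L h' l = ?ind ?x * ((\<Prod>j<d. \<Prod>i<j. of_real (l (Suc j)) - of_real (l (Suc i)))
        * (\<Prod>k<d. of_real (l (Suc k)) - of_real c) * (\<Prod>k<d. h' (l (Suc k))))"
      using mono by (simp add: indicator_def)
    also have "\<dots> = ?ind ?x * ((- 1) ^ d * (\<Sum>\<sigma> | \<sigma> permutes {..<Suc d}. of_int (sign \<sigma>) *
        (\<Prod>k<d. poly (p (\<sigma> k)) (of_real (l (Suc k))) * h' (l (Suc k))) * poly (p (\<sigma> d)) (of_real c)))"
      by (simp only: weighted_vandermonde_expansion[OF p, where y = "\<lambda>k. of_real (l (Suc k))" and c = "of_real c"
            and w = "\<lambda>k. h' (l (Suc k))" and d = d])
    also have "(\<Sum>\<sigma> | \<sigma> permutes {..<Suc d}. of_int (sign \<sigma>) *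
        (\<Prod>k<d. poly (p (\<sigma> k)) (of_real (l (Suc k))) * h' (l (Suc k))) * poly (p (\<sigma> d)) (of_real c)) =
        (\<Sum>\<sigma> | \<sigma> permutes {..<Suc d}. of_int (sign \<sigma>) * (\<Prod>k<d. g (\<sigma> k) (?x k)) * poly (p (\<sigma> d)) (of_real c))"
    proof (rule sum.cong[OF refl])
      fix \<sigma> assume "\<sigma> \<in> {\<sigma>. \<sigma> permutes {..<Suc d}}"
      then have \<sigma>: "\<sigma> k \<le> d" if "k < d" for k
        using permutes_in_image[of \<sigma> "{..<Suc d}" k] that by simp
      have "(\<Prod>k<d. poly (p (\<sigma> k)) (of_real (l (Suc k))) * h' (l (Suc k))) = (\<Prod>k<d. g (\<sigma> k) (?x k))"
        by (rule prod.cong[OF refl]) (simp add: g(2) \<sigma>)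
      then show "of_int (sign \<sigma>) * (\<Prod>k<d. poly (p (\<sigma> k)) (of_real (l (Suc k))) * h' (l (Suc k))) * poly (p (\<sigma> d)) (of_real c) =
          of_int (sign \<sigma>) * (\<Prod>k<d. g (\<sigma> k) (?x k)) * poly (p (\<sigma> d)) (of_real c)" by (simp only:)
    qed
    finally show ?thesis unfolding \<Phi>_def by (simp only: sum_distrib_left mult_ac)
  qed
  have L_meas: "?L h' \<in> borel_measurable (lborel_power ?I)"
  proof -
    have "(\<lambda>x. \<lambda>k\<in>?K. x (Suc k)) \<in> measurable (lborel_power ?I) (lborel_power ?K)"
      by (intro measurable_restrict measurable_component_singleton) auto
    from measurable_compose[OF this \<Phi>_meas] show ?thesis unfolding L_\<Phi> .
  qed
  have "(LINT l:{l. strict_mono_on ?I l}|lebesgue_pow d.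
            (\<Prod>(i, j)\<in>{(i, j). 1 \<le> i \<and> i < j \<and> j \<le> d}. of_real (l j - l i))
            * (\<Prod>i\<in>?I. of_real (l i - c)) * (\<Prod>i\<in>?I. h (l i))) = integral\<^sup>L (completion (lborel_power ?I)) (?L h)"
    unfolding set_lebesgue_integral_def lebesgue_pow_def ..
  also have "\<dots> = integral\<^sup>L (lborel_power ?I) (?L h')"
  proof (rule integral_completion_AE_eq[OF L_meas])
    show "AE l in lborel_power ?I. ?L h l = ?L h' l"
    proof (rule eventually_mono[OF AE_lborel_power_notin_null[OF _ h'(2)]])
      fix l :: "nat \<Rightarrow> real" assume "\<forall>k\<in>?I. l k \<notin> N"
      then have "(\<Prod>i\<in>?I. h (l i)) = (\<Prod>i\<in>?I. h' (l i))" by (intro prod.cong refl) (simp add: h'(3))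
      then show "?L h l = ?L h' l" by (simp only:)
    qed simp
  qed
  also have "\<dots> = (LINT x|lborel_power ?K. \<Phi> x)"
    unfolding L_\<Phi> by (rule integral_lborel_power_reindex[OF bij _ \<Phi>_meas]) simp
  also have "\<dots> = (- 1) ^ d * (\<Sum>\<sigma> | \<sigma> permutes {..<Suc d}.
      of_int (sign \<sigma>) * chamber_integral g d \<sigma> * poly (p (\<sigma> d)) (of_real c))"
  proof -
    have "(LINT x|lborel_power ?K. \<Phi> x) = (- 1) ^ d * (LINT x|lborel_power ?K. (\<Sum>\<sigma> | \<sigma> permutes {..<Suc d}.
      of_int (sign \<sigma>) * (?ind x * (\<Prod>k<d. g (\<sigma> k) (x k))) * poly (p (\<sigma> d)) (of_real c)))"
      unfolding \<Phi>_def by (rule integral_mult_right_zero)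
    also have "(LINT x|lborel_power ?K. (\<Sum>\<sigma> | \<sigma> permutes {..<Suc d}.
        of_int (sign \<sigma>) * (?ind x * (\<Prod>k<d. g (\<sigma> k) (x k))) * poly (p (\<sigma> d)) (of_real c))) =
      (\<Sum>\<sigma> | \<sigma> permutes {..<Suc d}. LINT x|lborel_power ?K.
        of_int (sign \<sigma>) * (?ind x * (\<Prod>k<d. g (\<sigma> k) (x k))) * poly (p (\<sigma> d)) (of_real c))"
      by (intro Bochner_Integration.integral_sum integrable_mult_left integrable_mult_right int)
    also have "\<dots> = (\<Sum>\<sigma> | \<sigma> permutes {..<Suc d}.
        of_int (sign \<sigma>) * chamber_integral g d \<sigma> * poly (p (\<sigma> d)) (of_real c))"
      unfolding chamber_integral_def by (simp only: integral_mult_right_zero integral_mult_left_zero)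
    finally show ?thesis .
  qed
  finally show ?thesis .
qed

section \<open>The integral as a bordered Pfaffian\<close>

lemma skew_block_mat_index:
  assumes "A \<in> carrier_mat n n" "B \<in> carrier_mat n k" "D \<in> carrier_mat k k" "i < n + k" "j < n + k"
  shows "skew_block_mat A B D $$ (i, j) =
    (if i < n then if j < n then A $$ (i, j) else B $$ (i, j - n)
     else if j < n then - (B $$ (j, i - n)) else D $$ (i - n, j - n))"
  using assms unfolding skew_block_mat_def by auto

lemma skew_on_skew_block_mat:
  assumes carrier: "A \<in> carrier_mat n n" "B \<in> carrier_mat n k" "D \<in> carrier_mat k k"
    and A: "skew_on n (\<lambda>i j. A $$ (i, j))" and D: "skew_on k (\<lambda>i j. D $$ (i, j))"
  shows "skew_on (n + k) (\<lambda>i j. skew_block_mat A B D $$ (i, j))"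
  unfolding skew_on_def
proof (intro allI impI)
  fix i j assume ij: "i < n + k" "j < n + k"
  have "A $$ (j, i) = - A $$ (i, j)" if "i < n" "j < n" using A that unfolding skew_on_def by blast
  moreover have "D $$ (j - n, i - n) = - D $$ (i - n, j - n)" if "\<not> i < n" "\<not> j < n"
  proof -
    have "i - n < k" "j - n < k" using that ij by linarith+
    then show ?thesis using D unfolding skew_on_def by blast
  qed
  ultimately show "skew_block_mat A B D $$ (j, i) = - skew_block_mat A B D $$ (i, j)"
    unfolding skew_block_mat_index[OF carrier ij] skew_block_mat_index[OF carrier ij(2,1)] by auto
qed

theorem lemma3p1:
  fixes d :: nat and h :: "real \<Rightarrow> complex" and p :: "nat \<Rightarrow> complex poly" and c :: real
  assumes "d \<ge> 1"
    and "h \<in> borel_measurable lebesgue"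
    and "integrable lebesgue (\<lambda>x. (1 + \<bar>x\<bar> ^ d) * cmod (h x))"
    and "\<And>i. i \<le> d \<Longrightarrow> degree (p i) = i \<and> lead_coeff (p i) = 1"
  shows "(LINT l:{l. strict_mono_on {1..d} l}|lebesgue_pow d.
            (\<Prod>(i, j)\<in>{(i, j). 1 \<le> i \<and> i < j \<and> j \<le> d}. of_real (l j - l i))
            * (\<Prod>i\<in>{1..d}. of_real (l i - c))
            * (\<Prod>i\<in>{1..d}. h (l i)))
         = (if even d
            then pf (skew_block_mat (Vmat d p h)
                   (mat_of_cols (d+1) [pvec d p c])
                   (mat_of_rows_list 1 [[0]]))
            else pf (skew_block_mat (Vmat d p h)
                   (mat_of_cols (d+1) [Wvec d p h, pvec d p c])
                   (mat_of_rows_list 2 [[0, 1], [-1, 0]]))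
                 - pf (Vmat d p h))"
proof -
  obtain h' N where h': "h' \<in> borel_measurable borel" "N \<in> null_sets lborel" "\<And>x. x \<notin> N \<Longrightarrow> h x = h' x"
    using lebesgue_measurable_complex_borel_version[OF assms(2)] by blast
  have weight_meas: "(\<lambda>x. (1 + \<bar>x\<bar> ^ d) * cmod (h' x)) \<in> borel_measurable lborel"
    using h'(1) by simp
  have "AE x in lborel. (1 + \<bar>x\<bar> ^ d) * cmod (h x) = (1 + \<bar>x\<bar> ^ d) * cmod (h' x)"
    using AE_not_in[OF h'(2)] by (rule eventually_mono) (simp add: h'(3))
  then have "integrable lebesgue (\<lambda>x. (1 + \<bar>x\<bar> ^ d) * cmod (h' x))"
    by (rule Bochner_Integration.integrable_cong_AE_imp[OF assms(3) measurable_completion[OF weight_meas] AE_completion])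
  then have weight: "integrable lborel (\<lambda>x. (1 + \<bar>x\<bar> ^ d) * cmod (h' x))"
    unfolding integrable_completion[OF weight_meas] .
  \<comment> \<open>The default \<open>0\<close> makes \<open>g j\<close> integrable for all \<open>j\<close>, also beyond the degrees controlled by the weight.\<close>
  define g where "g j x = (if j \<le> d then poly (p j) (of_real x) * h' x else 0)" for j and x :: real
  have g: "integrable lborel (g j)" for j
    using integrable_poly_mult_weight[OF h'(1) weight, of "p j"] assms(4)[of j] unfolding g_def by (cases "j \<le> d") simp_all
  have g_eq: "g j x = poly (p j) (of_real x) * h' x" if "j \<le> d" for j x using that by (simp add: g_def)
  note entries = Vmat_entry[OF h' g g_eq] Wvec_entry[OF h'(2,3) g g_eq]
  have Vc: "Vmat d p h \<in> carrier_mat (d+1) (d+1)" by (simp add: Vmat_def)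
  have Vskew: "skew_on (d+1) (\<lambda>i j. Vmat d p h $$ (i, j))"
    unfolding skew_on_def
  proof (intro allI impI)
    fix i j assume "i < d+1" "j < d+1"
    then show "Vmat d p h $$ (j, i) = - Vmat d p h $$ (i, j)"
      using pair_integral_antisym[OF g, where i = i and j = j] by (simp add: entries)
  qed
  have chamber: "(LINT l:{l. strict_mono_on {1..d} l}|lebesgue_pow d.
            (\<Prod>(i, j)\<in>{(i, j). 1 \<le> i \<and> i < j \<and> j \<le> d}. of_real (l j - l i))
            * (\<Prod>i\<in>{1..d}. of_real (l i - c)) * (\<Prod>i\<in>{1..d}. h (l i))) =
    (- 1) ^ d * (\<Sum>\<sigma> | \<sigma> permutes {..<Suc d}.
      of_int (sign \<sigma>) * chamber_integral g d \<sigma> * poly (p (\<sigma> d)) (of_real c))"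
    by (rule integral_vandermonde_chamber[OF h'(1,2)]) (fact h'(3) assms(4) g g_eq)+
  show ?thesis
  proof (cases "even d")
    case True
    then obtain m where m: "d = 2*m" by (elim evenE)
    let ?B = "mat_of_cols (d+1) [pvec d p c]" and ?D = "mat_of_rows_list 1 [[0]] :: complex mat"
    let ?A = "skew_block_mat (Vmat d p h) ?B ?D"
    have Bc: "?B \<in> carrier_mat (d+1) 1" by (rule carrier_matI) simp_all
    have Dc: "?D \<in> carrier_mat 1 1" by (rule carrier_matI) (simp_all add: mat_of_rows_list_def)
    note index = skew_block_mat_index[OF Vc Bc Dc]
    have "skew_on 1 (\<lambda>i j. ?D $$ (i, j))" by (simp add: skew_on_def mat_of_rows_list_def)
    note skew = skew_on_skew_block_mat[OF Vc Bc Dc Vskew this]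
    have "pf ?A = (\<Sum>\<sigma> | \<sigma> permutes {..<2*m+1}.
        of_int (sign \<sigma>) * chamber_integral g (2*m) \<sigma> * poly (p (\<sigma> (2*m))) (of_real c))"
    proof (rule pf_bordered_even[OF g])
      show "dim_row ?A = 2*m+2" using Vc Dc m by (simp add: skew_block_mat_def)
      show "skew_on (2*m+2) (\<lambda>i j. ?A $$ (i, j))" using skew m by simp
      show "?A $$ (i, j) = pair_integral g i j" if "i < 2*m+1" "j < 2*m+1" for i j
        using that m index[of i j] by (simp add: entries)
      show "?A $$ (i, 2*m+1) = poly (p i) (of_real c)" if "i < 2*m+1" for i
        using that m index[of i "2*m+1"] by (simp add: mat_of_cols_index pvec_def)
    qed
    then have "(- 1) ^ d * (\<Sum>\<sigma> | \<sigma> permutes {..<Suc d}.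
        of_int (sign \<sigma>) * chamber_integral g d \<sigma> * poly (p (\<sigma> d)) (of_real c)) = pf ?A"
      using m by simp
    from trans[OF chamber this] show ?thesis using True by (simp only: if_True)
  next
    case False
    then obtain m where m: "d = 2*m+1" by (elim oddE)
    let ?B = "mat_of_cols (d+1) [Wvec d p h, pvec d p c]" and ?D = "mat_of_rows_list 2 [[0, 1], [-1, 0]] :: complex mat"
    let ?A = "skew_block_mat (Vmat d p h) ?B ?D"
    have Bc: "?B \<in> carrier_mat (d+1) 2" by (rule carrier_matI) simp_all
    have Dc: "?D \<in> carrier_mat 2 2" by (rule carrier_matI) (simp_all add: mat_of_rows_list_def)
    note index = skew_block_mat_index[OF Vc Bc Dc]
    have "skew_on 2 (\<lambda>i j. ?D $$ (i, j))"
      by (auto simp: skew_on_def mat_of_rows_list_def less_2_cases_iff)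
    note skew = skew_on_skew_block_mat[OF Vc Bc Dc Vskew this]
    have "pf ?A - pf (Vmat d p h) = - (\<Sum>\<sigma> | \<sigma> permutes {..<2*m+2}.
        of_int (sign \<sigma>) * chamber_integral g (2*m+1) \<sigma> * poly (p (\<sigma> (2*m+1))) (of_real c))"
    proof (rule pf_bordered_odd[OF g])
      show "dim_row ?A = 2*m+4" using Vc Dc m by (simp add: skew_block_mat_def)
      show "dim_row (Vmat d p h) = 2*m+2" using Vc m by simp
      show "skew_on (2*m+4) (\<lambda>i j. ?A $$ (i, j))" using skew m by (simp add: numeral_eq_Suc)
      show "?A $$ (i, j) = pair_integral g i j" "Vmat d p h $$ (i, j) = pair_integral g i j"
        if "i < 2*m+2" "j < 2*m+2" for i j
        using that m index[of i j] by (simp_all add: entries)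
      show "?A $$ (i, 2*m+2) = integral\<^sup>L lborel (g i)" if "i < 2*m+2" for i
        using that m index[of i "2*m+2"] by (simp add: mat_of_cols_index entries)
      show "?A $$ (i, 2*m+3) = poly (p i) (of_real c)" if "i < 2*m+2" for i
        using that m index[of i "2*m+3"] by (simp add: mat_of_cols_index pvec_def)
      show "?A $$ (2*m+2, 2*m+3) = 1"
        using m index[of "2*m+2" "2*m+3"] by (simp add: mat_of_rows_list_def)
    qed
    then have "(- 1) ^ d * (\<Sum>\<sigma> | \<sigma> permutes {..<Suc d}.
        of_int (sign \<sigma>) * chamber_integral g d \<sigma> * poly (p (\<sigma> d)) (of_real c)) = pf ?A - pf (Vmat d p h)"
      using m by simp
    from trans[OF chamber this] show ?thesis using False by (simp only: if_False)
  qed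
qed

end
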